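(* For every Borel probability measure $\rho$ on $\mathbb{T}$, $$\mathcal{D}[\rho]\le\sqrt2\,\sqrt{\mathcal{H}[\rho]},$$ and this inequality is sharp: for every $c<\sqrt2$ there is a Borel probability measure $\rho$ on $\mathbb{T}$ with $\mathcal{D}[\rho]>c\sqrt{\mathcal{H}[\rho]}$.
   Context: $\mathbb{T}=\mathbb{R}/\mathbb{Z}$ with Lebesgue measure $|\cdot|$. $W(x)=-\log|2\sin(\pi x)|$ on $\mathbb{T}$ (with $W(0)=+\infty$), and $(W*\rho)(x)=\int_{\mathbb{T}}W(x-y)\,d\rho(y)\in(-\infty,\infty]$. Define $\mathcal{D}[\rho]=\sup_I(\rho(I)-|I|)$, the supremum over closed arcs $I\subset\mathbb{T}$ (of length $<1$), and $\mathcal{H}[\rho]=-\operatorname{ess\,inf}_{\mathbb{T}}(W*\rho)$, the essential infimum taken with respect to Lebesgue measure. *)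

theory Defs
  imports "HOL-Probability.Probability"
begin

text \<open>The circle T = R/Z is represented by the fundamental domain [0,1).
  A Borel probability measure on T is a probability measure on the Borel sets
  of the reals that is concentrated on [0,1).\<close>

definition torus_prob :: "real measure \<Rightarrow> bool" where
  "torus_prob \<rho> \<longleftrightarrow> prob_space \<rho> \<and> sets \<rho> = sets borel \<and> emeasure \<rho> (- {0..<1}) = 0"

definition arc :: "real \<Rightarrow> real \<Rightarrow> real set" where
  "arc a L = {x \<in> {0..<1}. frac (x - a) \<le> L}"

definition discr :: "real measure \<Rightarrow> real" where
  "discr \<rho> = (SUP p \<in> UNIV \<times> {0..<1}. measure \<rho> (arc (fst p) (snd p)) - snd p)"

text \<open>W(x) + log 2 \<ge> 0, with value +\<infinity> at integers.\<close>
definition Wshift :: "real \<Rightarrow> ennreal" where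
  "Wshift x = (if sin (pi * x) = 0 then \<infinity>
               else ennreal (- ln \<bar>2 * sin (pi * x)\<bar> + ln 2))"

text \<open>(W * rho)(x) in (-\<infinity>, \<infinity>]; well defined since W is bounded below by -log 2.\<close>
definition Wconv :: "real measure \<Rightarrow> real \<Rightarrow> ereal" where
  "Wconv \<rho> x = enn2ereal (\<integral>\<^sup>+ y. Wshift (x - y) \<partial>\<rho>) - ereal (ln 2)"

definition essinf :: "'a measure \<Rightarrow> ('a \<Rightarrow> ereal) \<Rightarrow> ereal" where
  "essinf M f = Sup {c. AE x in M. c \<le> f x}"

definition Henergy :: "real measure \<Rightarrow> ereal" where
  "Henergy \<rho> = - essinf (restrict_space lborel {0..<1}) (Wconv \<rho>)"

end

theory Submission
  imports Defs "HOL-Complex_Analysis.Cauchy_Integral_Formula"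
begin

text \<open>
  Write p_t and W_t for the Poisson kernel and the Poisson-smoothed kernel W at height t, so that
  the t-derivative of W_t is - pi (p_t - 1).

  Upper bound. By duality it is enough to find a probability density mu with
  W * mu \<le> C - \<delta> 1_I and C - \<delta> |I| \<le> \<delta>^2 / 2, where
  \<delta> = rho(I) - |I|; integrating W * rho against mu then gives H \<ge> \<delta>^2 / 2.
  The half-ellipse D_0(x) = pi sqrt(b^2 - x^2) with pi b = \<delta> has height \<delta>, area
  \<delta>^2 / 2, and satisfies D_0 - p_t * D_0 \<le> pi t, which expresses that
  D_0 = C - W * mu for a nonnegative mu. The last property survives suprema of translates, and the
  supremum D of the translates of D_0 by points of I equals \<delta> on I and exceeds
  \<delta> 1_I only by two quarter-ellipses of total area \<delta>^2 / 2. The density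
  1 - (D - p_t * D) / (pi t) plays the role of mu.

  Sharpness. The extremal measure for degenerate arcs is an atom of mass m at 0 together with the
  equilibrium distribution of the remaining mass on the complement of a gap around 0. Its Herglotz
  transform is w = q cosh A, where q^2 + m^2 = 1 and q sinh A = m (1 + z) / (1 - z), and its complex
  potential has A-derivative m w / (1 + w). This gives H \<le> m^2 / (2 q) while the discrepancy is
  at least m, and q may be taken arbitrarily close to 1. Evaluating the density on a circle of
  radius less than 1 keeps everything smooth.
\<close>

section \<open>Poisson kernels and the Cauchy formula on the unit circle\<close>

text \<open>W has Fourier coefficients 1 / (2 |k|) for k nonzero and mean 0, and the generator of
  the semigroup p_t has multiplier - 2 pi |k|. So 1 + (1 / pi) (generator of D) is a density mu with
  W * mu = C - D, where C is the integral of D, and mu \<ge> 0 is the infinitesimal form of D - p_t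
  * D \<le> pi t. A finite t keeps the test density continuous, and W_t in place of W keeps the
  kernel bounded; the errors are O(t) and disappear in a last limit. The half-ellipse is the natural
  profile because on the line the half-Laplacian of sqrt (b^2 - x^2) is constant on [-b, b]. For
  sharpness, w^2 = q^2 + m^2 ((1 + z) / (1 - z))^2 is real on the unit circle, namely q^2 - m^2
  cot^2 (pi x). Where it is negative, w is imaginary and there is no density (the gap); where it is
  positive, w is real and the potential is constant. Total mass 1 means w = 1 at z = 0, which forces
  q^2 + m^2 = 1. The resulting ratio m / sqrt (m^2 / (2 q)) is sqrt (2 q).\<close>

definition zp :: "real \<Rightarrow> real \<Rightarrow> complex" where
  "zp t x = exp (Complex (- 2 * pi * t) (2 * pi * x))"

definition den :: "real \<Rightarrow> real \<Rightarrow> real" where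
  "den t x = 1 - 2 * exp (- 2 * pi * t) * cos (2 * pi * x) + (exp (- 2 * pi * t))\<^sup>2"

definition pk :: "real \<Rightarrow> real \<Rightarrow> real" where
  "pk t x = (1 - (exp (- 2 * pi * t))\<^sup>2) / den t x"

text \<open>At the disc point z = \<open>zp t x\<close> this is - ln |1 - z|, the kernel W_t of the
  overview; at t = 0 the modulus is |2 sin (pi x)| and W itself results.\<close>

definition lnk :: "real \<Rightarrow> real \<Rightarrow> real" where
  "lnk t x = - ln (den t x) / 2"

lemma zp_mult: "zp s x * zp t y = zp (s + t) (x + y)"
  unfolding zp_def mult_exp_exp by (rule arg_cong[where f=exp]) (simp add: complex_eq_iff algebra_simps)

lemma norm_zp: "cmod (zp t x) = exp (- 2 * pi * t)"
  by (simp add: zp_def)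

lemma Re_zp: "Re (zp t x) = exp (- 2 * pi * t) * cos (2 * pi * x)"
  by (simp add: zp_def Re_exp)

lemma cnj_zp: "cnj (zp t x) = zp t (- x)"
  by (simp add: zp_def exp_cnj complex_cnj)

lemma zp_nonzero [simp]: "zp t x \<noteq> 0"
  by (simp add: zp_def)

lemma norm_zp_less: "t > 0 \<Longrightarrow> cmod (zp t x) < 1"
  by (simp add: norm_zp)

lemma zp_0_inverse: "inverse (zp 0 x) = zp 0 (- x)"
  using zp_mult[of 0 x 0 "-x"] by (intro inverse_unique) (simp add: zp_def Complex_eq)

lemma den_eq: "den t x = (cmod (1 - zp t x))\<^sup>2"
proof -
  have "(cmod (1 - zp t x))\<^sup>2 = 1 - 2 * Re (zp t x) + (cmod (zp t x))\<^sup>2"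
    by (simp only: cmod_power2) (simp add: power2_eq_square algebra_simps)
  then show ?thesis by (simp add: den_def norm_zp Re_zp)
qed

lemma den_ge: "den t x \<ge> (1 - exp (- 2 * pi * t))\<^sup>2"
proof -
  have "exp (- 2 * pi * t) * cos (2 * pi * x) \<le> exp (- 2 * pi * t) * 1"
    by (intro mult_left_mono) auto
  then show ?thesis by (simp add: den_def power2_eq_square algebra_simps)
qed

lemma den_pos: "t > 0 \<Longrightarrow> den t x > 0"
  using den_ge[of t x] by (smt (verit) exp_less_one_iff pi_gt_zero mult_pos_pos zero_less_power2 mult_minus_left)

lemma den_minus [simp]: "den t (- x) = den t x"
  by (simp add: den_def)

lemma pk_minus [simp]: "pk t (- x) = pk t x"
  by (simp add: pk_def)

lemma lnk_minus [simp]: "lnk t (- x) = lnk t x"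
  by (simp add: lnk_def)

lemma den_plus_1 [simp]: "den t (x + 1) = den t x"
  by (simp add: den_def distrib_left cos_add)

lemma pk_plus_1 [simp]: "pk t (x + 1) = pk t x"
  by (simp add: pk_def)

lemma pk_pos: "t > 0 \<Longrightarrow> pk t x > 0"
  unfolding pk_def
  by (intro divide_pos_pos den_pos) (simp_all add: power_less_one_iff exp_double[symmetric])

lemma lnk_Ln: "t > 0 \<Longrightarrow> lnk t x = - Re (Ln (1 - zp t x))"
proof -
  assume t: "t > 0"
  have "1 - zp t x \<noteq> 0"
    using norm_zp_less[OF t, of x] by auto
  then show ?thesis
    by (simp add: lnk_def den_eq ln_realpow)
qed

text \<open>With u on the unit circle and w = \<open>zp t y\<close>, the first summand at y - x
  becomes the Cauchy kernel u / (u - w), and the second becomes holomorphic in u and zero at u = 0.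
  The Poisson formula is then Cauchy's formula plus a mean value.\<close>

lemma pk_complex:
  assumes "t > 0"
  shows "complex_of_real (pk t x) = 1 / (1 - zp t x) + cnj (zp t x) / (1 - cnj (zp t x))"
proof -
  let ?z = "zp t x"
  have nz: "1 - ?z \<noteq> 0" using norm_zp_less[OF assms, of x] by auto
  then have nz': "1 - cnj ?z \<noteq> 0"
    by (metis complex_cnj_cancel_iff complex_cnj_diff complex_cnj_one complex_cnj_zero)
  have "1 / (1 - ?z) + cnj ?z / (1 - cnj ?z) = (1 - ?z * cnj ?z) / ((1 - ?z) * (1 - cnj ?z))"
    using nz nz' by (simp add: field_simps)
  also have "\<dots> = (1 - of_real ((cmod ?z)\<^sup>2)) / of_real ((cmod (1 - ?z))\<^sup>2)"
    by (simp only: complex_norm_square complex_cnj_diff complex_cnj_one)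
  also have "\<dots> = complex_of_real (pk t x)"
    by (simp add: pk_def den_eq norm_zp)
  finally show ?thesis by simp
qed

lemma pk_Re:
  assumes "t > 0"
  shows "pk t x = Re ((1 + zp t x) / (1 - zp t x))"
proof -
  have nz: "1 - zp t x \<noteq> 0" using norm_zp_less[OF assms, of x] by auto
  have "pk t x = Re (1 / (1 - zp t x) + cnj (zp t x / (1 - zp t x)))"
    using pk_complex[OF assms, of x] by (metis Re_complex_of_real complex_cnj_diff complex_cnj_divide complex_cnj_one)
  also have "\<dots> = Re (1 / (1 - zp t x) + zp t x / (1 - zp t x))"
    by (simp only: plus_complex.sel cnj.sel)
  also have "\<dots> = Re ((1 + zp t x) / (1 - zp t x))" by (simp only: add_divide_distrib)
  finally show ?thesis .
qed

section \<open>Cauchy, mean value and Poisson formulas on the unit circle\<close>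

lemma cauchy_unit_circle:
  assumes f: "f holomorphic_on ball 0 R" and R: "R > 1" and w: "cmod w < 1"
  shows "((\<lambda>x. f (zp 0 x) * zp 0 x / (zp 0 x - w)) has_integral f w) {0..1}"
proof -
  have "f holomorphic_on cball 0 1"
    using f R by (auto intro: holomorphic_on_subset)
  then have "((\<lambda>u. f u / (u - w)) has_contour_integral (2 * of_real pi * \<i> * f w)) (circlepath 0 1)"
    using w by (intro Cauchy_integral_circlepath_simple) auto
  then have "((\<lambda>x. f (circlepath 0 1 x) / (circlepath 0 1 x - w)
       * vector_derivative (circlepath 0 1) (at x within {0..1})) has_integral (2 * of_real pi * \<i> * f w)) {0..1}"
    by (simp add: has_contour_integral_def)
  then have "((\<lambda>x. (1 / (2 * of_real pi * \<i>)) * (f (circlepath 0 1 x) / (circlepath 0 1 x - w)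
       * vector_derivative (circlepath 0 1) (at x within {0..1}))) has_integral
       (1 / (2 * of_real pi * \<i>)) * (2 * of_real pi * \<i> * f w)) {0..1}"
    by (rule has_integral_mult_right)
  moreover have "circlepath 0 1 x = zp 0 x" for x
    by (simp add: circlepath zp_def Complex_eq mult_ac)
  ultimately have "((\<lambda>x. (1 / (2 * of_real pi * \<i>)) * (f (zp 0 x) / (zp 0 x - w)
       * vector_derivative (circlepath 0 1) (at x within {0..1}))) has_integral f w) {0..1}"
    by simp
  then show ?thesis
  proof (rule has_integral_eq[rotated])
    fix x :: real assume "x \<in> {0..1}"
    then have vd: "vector_derivative (circlepath 0 1) (at x within {0..1}) = 2 * of_real pi * \<i> * zp 0 x"
      by (simp add: vector_derivative_circlepath01 zp_def Complex_eq mult_ac)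
    have cancel: "1 / c * (a / d * (c * z)) = a * z / d" if "c \<noteq> 0" for a c d z :: complex
      using that by simp
    show "1 / (2 * of_real pi * \<i>) * (f (zp 0 x) / (zp 0 x - w)
       * vector_derivative (circlepath 0 1) (at x within {0..1})) = f (zp 0 x) * zp 0 x / (zp 0 x - w)"
      unfolding vd by (rule cancel) simp
  qed
qed

lemma mean_value_unit_circle:
  assumes f: "f holomorphic_on ball 0 R" and R: "R > 1"
  shows "((\<lambda>x. f (zp 0 x)) has_integral f 0) {0..1}"
  using cauchy_unit_circle[OF assms, of 0] by simp

lemma poisson_unit_circle:
  assumes f: "f holomorphic_on ball 0 R" and R: "R > 1" and t: "t > 0"
  shows "((\<lambda>x. f (zp 0 x) * of_real (pk t (y - x))) has_integral f (zp t y)) {0..1}"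
proof -
  let ?w = "zp t y"
  \<comment> \<open>The function u / (1 - cnj w u) has its pole at modulus exp (2 pi t), so the
    common disc of holomorphy has to stop there.\<close>
  define R' where "R' = min R (exp (2 * pi * t))"
  have R': "R' > 1" using R t by (simp add: R'_def)
  have nz: "1 - cnj ?w * u \<noteq> 0" if "u \<in> ball 0 R'" for u
  proof
    assume "1 - cnj ?w * u = 0"
    then have "cmod (cnj ?w * u) = 1" by (metis norm_one right_minus_eq)
    then have "exp (- 2 * pi * t) * cmod u = 1" by (simp add: norm_mult norm_zp)
    then have "cmod u = exp (2 * pi * t)" by (simp add: exp_minus field_simps)
    then show False using that by (simp add: R'_def)
  qed
  have h: "(\<lambda>u. f u * (cnj ?w * u / (1 - cnj ?w * u))) holomorphic_on ball 0 R'"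
    using nz by (intro holomorphic_intros holomorphic_on_subset[OF f]) (auto simp: R'_def)
  have A: "((\<lambda>x. f (zp 0 x) * zp 0 x / (zp 0 x - ?w) + f (zp 0 x) * (cnj ?w * zp 0 x / (1 - cnj ?w * zp 0 x)))
     has_integral f ?w + 0) {0..1}"
    using cauchy_unit_circle[OF f R norm_zp_less[OF t, of y]] mean_value_unit_circle[OF h R']
    by (intro has_integral_add) auto
  have "f (zp 0 x) * zp 0 x / (zp 0 x - ?w) + f (zp 0 x) * (cnj ?w * zp 0 x / (1 - cnj ?w * zp 0 x))
      = f (zp 0 x) * of_real (pk t (y - x))" for x
  proof -
    have 1: "zp t (y - x) = ?w / zp 0 x"
      using zp_mult[of t y 0 "-x"] zp_0_inverse[of x] by (simp add: divide_inverse)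
    have 2: "cnj (zp t (y - x)) = cnj ?w * zp 0 x"
      unfolding cnj_zp using zp_mult[of t "-y" 0 x] by (simp add: algebra_simps)
    have ne: "zp 0 x \<noteq> ?w"
      using norm_zp_less[OF t, of y] norm_zp[of 0 x] by auto
    have "1 / (1 - ?w / zp 0 x) = zp 0 x / (zp 0 x - ?w)"
      using ne by (simp add: field_simps)
    then show ?thesis
      unfolding pk_complex[OF t] 2 unfolding 1 by (simp add: algebra_simps)
  qed
  then show ?thesis using A by simp
qed

lemma has_integral_Re: "((f :: real \<Rightarrow> complex) has_integral I) S \<Longrightarrow> ((\<lambda>x. Re (f x)) has_integral Re I) S"
  using has_integral_linear[OF _ bounded_linear_Re] by (simp add: o_def)

lemma poisson_Re:
  assumes "f holomorphic_on ball 0 R" "R > 1" "t > 0"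
  shows "((\<lambda>x. Re (f (zp 0 x)) * pk t (y - x)) has_integral Re (f (zp t y))) {0..1}"
  using has_integral_Re[OF poisson_unit_circle[OF assms, of y]] by simp

lemma mean_value_Re:
  assumes "f holomorphic_on ball 0 R" "R > 1"
  shows "((\<lambda>x. Re (f (zp 0 x))) has_integral Re (f 0)) {0..1}"
  using has_integral_Re[OF mean_value_unit_circle[OF assms]] by simp

lemma integral_pk:
  assumes "t > 0" shows "((\<lambda>x. pk t (y - x)) has_integral 1) {0..1}"
  using poisson_Re[of "\<lambda>_. 1" 2 t y] assms by simp

section \<open>Convolution identities for the smoothed logarithmic kernel\<close>

lemma lnk_holomorphic:
  assumes s: "s > 0"
  shows "(\<lambda>u. - Ln (1 - zp s (- y) * u)) holomorphic_on ball 0 (exp (2 * pi * s))"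
proof -
  have "1 - zp s (- y) * u \<notin> \<real>\<^sub>\<le>\<^sub>0" if "u \<in> ball 0 (exp (2 * pi * s))" for u
  proof -
    have "cmod (zp s (- y) * u) < exp (- 2 * pi * s) * exp (2 * pi * s)"
      unfolding norm_mult norm_zp using that by (intro mult_strict_left_mono) auto
    then have "cmod (zp s (- y) * u) < 1" by (simp add: exp_minus)
    then have "Re (zp s (- y) * u) < 1"
      using complex_Re_le_cmod[of "zp s (- y) * u"] by linarith
    then show ?thesis by (simp add: complex_nonpos_Reals_iff)
  qed
  then show ?thesis by (intro holomorphic_intros) auto
qed

lemma lnk_Re:
  assumes "s + t > 0"
  shows "Re (- Ln (1 - zp s (- y) * zp t x)) = lnk (s + t) (x - y)"
  using assms by (simp add: zp_mult lnk_Ln)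

text \<open>The function \<open>lnk s (x - y)\<close> of x is the boundary value of a harmonic
  function on a disc larger than the unit disc, so its Poisson integral is the value at an interior
  point, and heights add.\<close>

lemma lnk_conv_pk:
  assumes s: "s > 0" and t: "t > 0"
  shows "((\<lambda>x. lnk s (x - y) * pk t (x - z)) has_integral lnk (s + t) (z - y)) {0..1}"
proof -
  have R: "exp (2 * pi * s) > 1" using s by simp
  have "pk t (z - x) = pk t (x - z)" for x
    using pk_minus[of t "x - z"] by simp
  then show ?thesis
    using poisson_Re[OF lnk_holomorphic[OF s, of y] R t, of z] lnk_Re[of s 0 y] lnk_Re[of s t y z] s t
    by (simp add: zp_mult lnk_Ln)
qed

lemma integral_lnk:
  assumes s: "s > 0"
  shows "((\<lambda>x. lnk s (x - y)) has_integral 0) {0..1}"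
proof -
  have R: "exp (2 * pi * s) > 1" using s by simp
  show ?thesis using mean_value_Re[OF lnk_holomorphic[OF s, of y] R] lnk_Re[of s 0 y] s
    by (simp add: zp_mult lnk_Ln)
qed

text \<open>This links potentials to Poisson integrals. It feeds the mean value theorem in
  \<open>integral_lnk_dual_density\<close> and the comparison of t-derivatives in
  \<open>conv_lnk_dens\<close>.\<close>

lemma lnk_has_derivative:
  assumes "t > 0"
  shows "((\<lambda>t. lnk t x) has_real_derivative - pi * (pk t x - 1)) (at t)"
proof -
  have "den t x > 0" using den_pos[OF assms] .
  then show ?thesis
    unfolding lnk_def den_def pk_def
    by (auto intro!: derivative_eq_intros simp: field_simps power2_eq_square)
qed

section \<open>The Poisson integral of a semicircle\<close>

lemma continuous_on_den [continuous_intros]: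
  fixes S :: "'a::t2_space set"
  assumes "continuous_on S f" "continuous_on S g"
  shows "continuous_on S (\<lambda>x. den (f x) (g x))"
  unfolding den_def by (intro continuous_intros assms)

lemma continuous_on_pk [continuous_intros]:
  fixes S :: "'a::t2_space set"
  assumes "continuous_on S f" "continuous_on S g" "\<And>x. x \<in> S \<Longrightarrow> f x > 0"
  shows "continuous_on S (\<lambda>x. pk (f x) (g x))"
  unfolding pk_def using den_pos[OF assms(3)]
  by (intro continuous_intros assms) (metis less_irrefl)

lemma continuous_on_lnk [continuous_intros]:
  fixes S :: "'a::t2_space set"
  assumes "continuous_on S f" "continuous_on S g" "\<And>x. x \<in> S \<Longrightarrow> f x > 0"
  shows "continuous_on S (\<lambda>x. lnk (f x) (g x))"
  unfolding lnk_def using den_pos[OF assms(3)]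
  by (intro continuous_intros assms) (auto, metis less_irrefl)

lemma continuous_on_zp [continuous_intros]:
  fixes S :: "'a::t2_space set"
  assumes "continuous_on S f" "continuous_on S g"
  shows "continuous_on S (\<lambda>x. zp (f x) (g x))"
  unfolding zp_def Complex_eq by (intro continuous_intros assms)

section \<open>The Poisson kernel of the circle against that of the line\<close>

lemma le_sinh:
  fixes x :: real
  assumes "0 \<le> x"
  shows "x \<le> sinh x"
proof -
  have "(exp x - inverse (exp x)) / 2 = sinh x" by (simp add: sinh_field_def exp_minus)
  then show ?thesis using real_le_abs_sinh[of x] assms by (simp only: abs_of_nonneg sinh_real_nonneg_iff)
qed

lemma sinh_le_mult_cosh:
  fixes x :: real
  assumes "x \<ge> 0"
  shows "sinh x \<le> x * cosh x"
proof -
  have "x * cosh x - sinh x \<ge> 0 * cosh 0 - sinh (0::real)"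
    using assms
    by (rule DERIV_nonneg_imp_nondecreasing)
       (auto intro!: exI derivative_eq_intros simp: mult_nonneg_nonneg)
  then show ?thesis by simp
qed

lemma pk_sinh:
  assumes "t > 0"
  shows "pk t x = sinh (pi * t) * cosh (pi * t) / ((sinh (pi * t))\<^sup>2 + (sin (pi * x))\<^sup>2)"
proof -
  define e where "e = exp (pi * t)"
  have e: "e > 0" by (simp add: e_def)
  have r: "exp (- 2 * pi * t) = 1 / e\<^sup>2"
    by (simp add: e_def exp_minus exp_double[symmetric] field_simps power2_eq_square exp_add[symmetric])
  have s: "sinh (pi * t) = (e - 1 / e) / 2" "cosh (pi * t) = (e + 1 / e) / 2"
    by (simp_all add: sinh_def cosh_def e_def exp_minus inverse_eq_divide)
  have c: "cos (2 * pi * x) = 1 - 2 * (sin (pi * x))\<^sup>2"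
    using cos_double_sin[of "pi * x"] by (simp add: mult.assoc)
  have d: "den t x = 4 / e\<^sup>2 * ((sinh (pi * t))\<^sup>2 + (sin (pi * x))\<^sup>2)"
    unfolding den_def r s c using e by (simp add: field_simps power2_eq_square)
  have n: "1 - (exp (- 2 * pi * t))\<^sup>2 = 4 / e\<^sup>2 * (sinh (pi * t) * cosh (pi * t))"
    unfolding r s using e by (simp add: field_simps power2_eq_square)
  show ?thesis unfolding pk_def d n using e by (simp only: mult_divide_mult_cancel_left_if) simp
qed

text \<open>The circle kernel is the periodization of the line kernel t / (pi (t^2 + y^2)), hence
  dominates its central term. Instead of a summation, the closed form \<open>pk_sinh\<close> is
  compared with the fraction by sinh s \<le> s cosh s, s \<le> sinh s and |sin s| \<le> |s|.\<close>

lemma pk_ge_line: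
  assumes t: "t > 0"
  shows "t / (t\<^sup>2 + y\<^sup>2) \<le> pi * pk t y"
proof -
  let ?S = "sinh (pi * t)" and ?C = "cosh (pi * t)"
  have S: "?S > 0" using t by simp
  have 1: "t * ?S\<^sup>2 \<le> pi * t\<^sup>2 * (?S * ?C)"
  proof -
    have "?S \<le> pi * t * ?C" using t by (intro sinh_le_mult_cosh) auto
    then have "t * ?S * ?S \<le> t * ?S * (pi * t * ?C)"
      using t S by (intro mult_left_mono) auto
    then show ?thesis by (simp add: power2_eq_square mult_ac)
  qed
  have 2: "t * (sin (pi * y))\<^sup>2 \<le> pi * y\<^sup>2 * (?S * ?C)"
  proof -
    have "(sin (pi * y))\<^sup>2 \<le> (pi * y)\<^sup>2"
      using abs_sin_x_le_abs_x abs_le_square_iff by blast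
    then have "t * (sin (pi * y))\<^sup>2 \<le> t * (pi * y)\<^sup>2" using t by simp
    also have "\<dots> = pi * y\<^sup>2 * ((pi * t) * 1)" by (simp add: power2_eq_square)
    also have "\<dots> \<le> pi * y\<^sup>2 * (?S * ?C)"
    proof (intro mult_left_mono mult_mono)
      show "pi * t \<le> ?S" using t by (intro le_sinh) simp
    qed (use t S cosh_real_ge_1 in auto)
    finally show ?thesis .
  qed
  have "t * (?S\<^sup>2 + (sin (pi * y))\<^sup>2) \<le> pi * (?S * ?C) * (t\<^sup>2 + y\<^sup>2)"
    using 1 2 by (simp add: algebra_simps)
  moreover have "?S\<^sup>2 + (sin (pi * y))\<^sup>2 > 0" "t\<^sup>2 + y\<^sup>2 > 0"
    using S t by (auto intro!: add_pos_nonneg)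
  ultimately show ?thesis
    unfolding pk_sinh[OF t] by (simp add: field_simps)
qed

section \<open>The Stieltjes transform of the semicircle law\<close>

lemma zp_eq_cis: "zp 0 x = cis (2 * pi * x)"
  by (simp add: zp_def cis_conv_exp Complex_eq mult_ac)

text \<open>This is the Stieltjes transform of the semicircle law in the coordinate z with z + 1/z =
  2 w, after y = cos (2 pi v). Partial fractions write the integrand as Q u + Q (1/u) with u on the
  unit circle, so the mean of Q is enough.\<close>

lemma semicircle_stieltjes_circle:
  assumes z: "cmod z < 1"
  shows "((\<lambda>x. 2 * z * (of_real (sin (2 * pi * x)))\<^sup>2 / (1 - 2 * z * of_real (cos (2 * pi * x)) + z\<^sup>2)) has_integral z) {0..1}"
proof -
  define Q where "Q u = - (u - inverse u) / (2 * (1 - z * u))" for u :: complex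
  obtain R where R: "R > 1" "\<And>u. u \<in> ball 0 R \<Longrightarrow> 1 - z * u \<noteq> 0"
  proof (cases "z = 0")
    case True then show ?thesis using that[of 2] by auto
  next
    case False
    have "1 - z * u \<noteq> 0" if "u \<in> ball 0 (1 / cmod z)" for u
    proof
      assume "1 - z * u = 0"
      then have "cmod (z * u) = 1" by (metis norm_one right_minus_eq)
      then show False using that False by (simp add: norm_mult field_simps)
    qed
    then show ?thesis using that[of "1 / cmod z"] z False by auto
  qed
  \<comment> \<open>Q has a pole at 0 with principal part \<open>inverse u / 2\<close>. Removing it
    leaves this function, and the removed term has mean zero on the circle.\<close>
  have h: "(\<lambda>u. - (u - z) / (2 * (1 - z * u))) holomorphic_on ball 0 R"
    using R by (intro holomorphic_intros) auto
  have 1: "((\<lambda>x. - (zp 0 x - z) / (2 * (1 - z * zp 0 x))) has_integral z / 2) {0..1}"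
    using mean_value_unit_circle[OF h R(1)] by simp
  have "((\<lambda>x. cnj (zp 0 x)) has_integral cnj 0) {0..1}"
    using mean_value_unit_circle[of "\<lambda>u. u" 2] has_integral_linear[OF _ bounded_linear_cnj, of "\<lambda>x. zp 0 x" 0 "{0..1}"]
    by (auto simp: o_def)
  then have "((\<lambda>x. inverse (zp 0 x) / 2) has_integral 0 / 2) {0..1}"
    by (intro has_integral_divide) (simp add: cnj_zp zp_0_inverse)
  from has_integral_add[OF 1 this]
  have "((\<lambda>x. - (zp 0 x - z) / (2 * (1 - z * zp 0 x)) + inverse (zp 0 x) / 2) has_integral z / 2) {0..1}"
    by simp
  moreover have "- (zp 0 x - z) / (2 * (1 - z * zp 0 x)) + inverse (zp 0 x) / 2 = Q (zp 0 x)" for x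
  proof -
    have "1 - z * zp 0 x \<noteq> 0" using R by (simp add: norm_zp)
    then show ?thesis unfolding Q_def by (simp add: field_simps)
  qed
  ultimately have Q1: "((\<lambda>x. Q (zp 0 x)) has_integral z / 2) {0..1}" by simp
  \<comment> \<open>The substitution x -> 1 - x replaces u by 1/u, so the two halves of the
    integrand contribute equally.\<close>
  have "((\<lambda>x. Q (zp 0 (- 1 * x + 1))) has_integral (1 / \<bar>-1\<bar>) *\<^sub>R (z / 2)) ((\<lambda>x. (1 / (-1)) *\<^sub>R x + - ((1 / (-1)) *\<^sub>R (1::real))) ` cbox 0 1)"
    using has_integral_affinity[of "\<lambda>x. Q (zp 0 x)" "z/2" 0 1 "-1" 1] Q1 by simp
  moreover have "(\<lambda>x::real. 1 - x) ` {0..1} = {0..1}"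
    by (auto simp: image_iff intro!: bexI[where x="1 - _"])
  moreover have "zp 0 (1 - x) = zp 0 (- x)" for x
    by (simp add: zp_eq_cis complex_eq_iff right_diff_distrib cos_diff sin_diff)
  ultimately have Q2: "((\<lambda>x. Q (zp 0 (- x))) has_integral z / 2) {0..1}"
    by simp
  have "Q (zp 0 x) + Q (zp 0 (-x)) = 2 * z * (of_real (sin (2 * pi * x)))\<^sup>2 / (1 - 2 * z * of_real (cos (2 * pi * x)) + z\<^sup>2)" for x
  proof -
    let ?u = "zp 0 x" and ?v = "zp 0 (- x)"
    have uv: "?u * ?v = 1" using zp_0_inverse[of x] by (metis zp_nonzero right_inverse)
    have inv: "inverse ?u = ?v" "inverse ?v = ?u" using zp_0_inverse[of x] zp_0_inverse[of "-x"] by auto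
    have cs: "of_real (cos (2 * pi * x)) = (?u + ?v) / 2" "of_real (sin (2 * pi * x)) = (?u - ?v) / (2 * \<i>)"
      by (simp_all add: zp_eq_cis complex_eq_iff)
    have nz: "1 - z * ?u \<noteq> 0" "1 - z * ?v \<noteq> 0" using R by (simp_all add: norm_zp)
    have "1 - 2 * z * ((?u + ?v) / 2) + z\<^sup>2 = (1 - z * ?u) * (1 - z * ?v)"
    proof -
      have "(1 - z * ?u) * (1 - z * ?v) = 1 - z * (?u + ?v) + z * z * (?u * ?v)"
        by (simp add: algebra_simps)
      then show ?thesis unfolding uv by (simp add: power2_eq_square)
    qed
    moreover have "Q ?u + Q ?v = 2 * z * ((?u - ?v) / (2 * \<i>))\<^sup>2 / ((1 - z * ?u) * (1 - z * ?v))"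
    proof -
      have "- d / (2 * a) + d / (2 * e) = d * (a - e) / (2 * (a * e))" if "a \<noteq> 0" "e \<noteq> 0" for a d e :: complex
        using that by (simp add: field_simps)
      from this[OF nz, of "?u - ?v"]
      have "Q ?u + Q ?v = (?u - ?v) * ((1 - z * ?u) - (1 - z * ?v)) / (2 * ((1 - z * ?u) * (1 - z * ?v)))"
        unfolding Q_def inv by (simp add: minus_divide_left)
      also have "(?u - ?v) * ((1 - z * ?u) - (1 - z * ?v)) = 2 * (2 * z * ((?u - ?v) / (2 * \<i>))\<^sup>2)"
        by (simp add: power_divide power_mult_distrib) (simp add: power2_eq_square algebra_simps)
      finally show ?thesis by (simp only: mult_divide_mult_cancel_left_if) simp
    qed
    ultimately show ?thesis unfolding cs by simp
  qed
  then show ?thesis using has_integral_add[OF Q1 Q2] by simp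
qed

text \<open>The solutions w +- sqrt (w^2 - 1) have product 1. A solution on the unit circle would
  satisfy 1/z = cnj z and make w real, so one solution lies strictly inside.\<close>

lemma joukowski_preimage:
  assumes "Im w \<noteq> 0"
  obtains z where "cmod z < 1" "z \<noteq> 0" "z + inverse z = 2 * w"
proof -
  note intro_z = that
  let ?c = "csqrt (w\<^sup>2 - 1)"
  have prod: "(w + ?c) * (w - ?c) = 1"
    by (simp add: algebra_simps flip: power2_eq_square)
  have key: thesis if "cmod z \<le> 1" "z * v = 1" "z + v = 2 * w" for z v
  proof -
    have v: "v = inverse z" using that(2) by (metis inverse_unique)
    have nz: "z \<noteq> 0" using that by auto
    have "cmod z \<noteq> 1"
    proof
      assume "cmod z = 1"
      then have "inverse z = cnj z" using nz by (metis complex_norm_square inverse_unique of_real_1 one_power2)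
      then show False using that(3) v assms by (simp add: complex_eq_iff)
    qed
    then show thesis using that nz v by (intro intro_z[of z]) auto
  qed
  show thesis
  proof (cases "cmod (w + ?c) \<le> 1")
    case True then show ?thesis using prod by (intro key) auto
  next
    case False
    have "cmod (w + ?c) * cmod (w - ?c) = 1" using prod by (metis norm_mult norm_one)
    then have "cmod (w - ?c) \<le> 1" using False
      by (metis mult.commute mult_left_le_one_le mult_le_cancel_right1 norm_ge_zero nle_le not_le order_trans)
    then show ?thesis using prod by (intro key[of "w - ?c" "w + ?c"]) (auto simp: mult.commute)
  qed
qed

text \<open>The integrand is - b times the imaginary part of the Stieltjes kernel at w = (x + i t) /
  b, so the integral is - b Im z for the Joukowski preimage z. Since z = w - s with s^2 = w^2 - 1,
  this is b Im s - t, and Im s is at least sqrt (1 - (x/b)^2).\<close>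

lemma semicircle_poisson_circle:
  assumes b: "b > 0" and t: "t > 0" and x: "\<bar>x\<bar> \<le> b"
  shows "integral {0..1} (\<lambda>v. (b * sin (2 * pi * v))\<^sup>2 * (t / (t\<^sup>2 + (x - b * cos (2 * pi * v))\<^sup>2))) \<ge> sqrt (b\<^sup>2 - x\<^sup>2) - t"
proof -
  define w where "w = Complex (x / b) (t / b)"
  have "Im w \<noteq> 0" using b t by (simp add: w_def)
  then obtain z where z: "cmod z < 1" "z \<noteq> 0" "z + inverse z = 2 * w"
    by (rule joukowski_preimage)
  have eq: "Im (2 * z * (of_real (sin (2 * pi * v)))\<^sup>2 / (1 - 2 * z * of_real (cos (2 * pi * v)) + z\<^sup>2))
     = - (1 / b) * ((b * sin (2 * pi * v))\<^sup>2 * (t / (t\<^sup>2 + (x - b * cos (2 * pi * v))\<^sup>2)))" for v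
  proof -
    let ?s = "sin (2 * pi * v)" and ?c = "cos (2 * pi * v)"
    have "1 - 2 * z * of_real ?c + z\<^sup>2 = z * (z + inverse z - 2 * of_real ?c)"
      using z(2) by (simp add: algebra_simps power2_eq_square)
    also have "\<dots> = 2 * z * (w - of_real ?c)" unfolding z(3) by (simp add: algebra_simps)
    finally have "2 * z * (of_real ?s)\<^sup>2 / (1 - 2 * z * of_real ?c + z\<^sup>2) = of_real (?s\<^sup>2) / (w - of_real ?c)"
      using z(2) by simp
    also have "Im \<dots> = - (?s\<^sup>2 * (t / b)) / ((x / b - ?c)\<^sup>2 + (t / b)\<^sup>2)"
      by (simp add: Im_divide w_def)
    also have "(x / b - ?c)\<^sup>2 + (t / b)\<^sup>2 = (t\<^sup>2 + (x - b * ?c)\<^sup>2) / b\<^sup>2"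
      using b by (simp add: field_simps power2_eq_square)
    also have "- (?s\<^sup>2 * (t / b)) / ((t\<^sup>2 + (x - b * ?c)\<^sup>2) / b\<^sup>2) = - (1 / b) * ((b * ?s)\<^sup>2 * (t / (t\<^sup>2 + (x - b * ?c)\<^sup>2)))"
      using b by (simp add: power2_eq_square)
    finally show ?thesis .
  qed
  have "((\<lambda>v. Im (2 * z * (of_real (sin (2 * pi * v)))\<^sup>2 / (1 - 2 * z * of_real (cos (2 * pi * v)) + z\<^sup>2))) has_integral Im z) {0..1}"
    using has_integral_linear[OF semicircle_stieltjes_circle[OF z(1)] bounded_linear_Im] by (simp add: o_def)
  then have "((\<lambda>v. (- b) * (- (1 / b) * ((b * sin (2 * pi * v))\<^sup>2 * (t / (t\<^sup>2 + (x - b * cos (2 * pi * v))\<^sup>2))))) has_integral (- b) * Im z) {0..1}"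
    unfolding eq by (rule has_integral_mult_right)
  then have I: "integral {0..1} (\<lambda>v. (b * sin (2 * pi * v))\<^sup>2 * (t / (t\<^sup>2 + (x - b * cos (2 * pi * v))\<^sup>2))) = - b * Im z"
    using b by (simp add: integral_unique)
  define \<rho> where "\<rho> = cmod z"
  have \<rho>: "\<rho> > 0" using z(2) by (simp add: \<rho>_def)
  have inv: "inverse z = cnj z / of_real (\<rho>\<^sup>2)"
    unfolding \<rho>_def using z(2) complex_norm_square[of z] by (simp add: field_simps)
  have re: "Re z * (1 + 1 / \<rho>\<^sup>2) = 2 * (x / b)"
    using arg_cong[OF z(3), of Re] unfolding inv by (simp add: w_def algebra_simps Re_divide_of_real)
  have im: "Im z * (1 - 1 / \<rho>\<^sup>2) = 2 * (t / b)"
    using arg_cong[OF z(3), of Im] unfolding inv by (simp add: w_def algebra_simps Im_divide_of_real)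
  have "1 / \<rho>\<^sup>2 > 1" using \<rho> z(1) by (simp add: \<rho>_def[symmetric] power_less_one_iff)
  then have neg: "Im z < 0" using im t b
    by (smt (verit) divide_pos_pos mult_nonneg_nonpos)
  \<comment> \<open>This is the imaginary part of s = (1/z - z) / 2, a square root of w^2 -
    1.\<close>
  define y where "y = - Im z * (1 + 1 / \<rho>\<^sup>2) / 2"
  have y0: "y \<ge> 0" unfolding y_def using neg \<rho> by (intro divide_nonneg_nonneg mult_nonneg_nonneg) auto
  have "y\<^sup>2 + (x / b)\<^sup>2 = ((Im z)\<^sup>2 + (Re z)\<^sup>2) * (1 + 1 / \<rho>\<^sup>2)\<^sup>2 / 4"
  proof -
    define k where "k = 1 + 1 / \<rho>\<^sup>2"
    have "x / b = Re z * k / 2" using re by (simp add: k_def)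
    then have "(x / b)\<^sup>2 = (Re z * k / 2)\<^sup>2" by (rule arg_cong)
    then show ?thesis
      unfolding y_def k_def[symmetric] power_divide power_mult_distrib by (simp add: algebra_simps)
  qed
  also have "\<dots> = \<rho>\<^sup>2 * (1 + 1 / \<rho>\<^sup>2)\<^sup>2 / 4" by (simp add: \<rho>_def cmod_power2 add.commute)
  also have "\<dots> = (\<rho> + 1 / \<rho>)\<^sup>2 / 4" using \<rho> by (simp add: power2_eq_square field_simps)
  also have "\<dots> \<ge> 1"
  proof -
    have "(\<rho> + 1 / \<rho>)\<^sup>2 = (\<rho> - 1 / \<rho>)\<^sup>2 + 4" using \<rho> by (simp add: power2_eq_square field_simps)
    then show ?thesis by simp
  qed
  finally have "1 - (x / b)\<^sup>2 \<le> y\<^sup>2" by simp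
  then have "b\<^sup>2 * (1 - (x / b)\<^sup>2) \<le> b\<^sup>2 * y\<^sup>2" using b by (intro mult_left_mono) auto
  moreover have "b\<^sup>2 * (1 - (x / b)\<^sup>2) = b\<^sup>2 - x\<^sup>2" using b by (simp add: field_simps)
  ultimately have "b\<^sup>2 - x\<^sup>2 \<le> (b * y)\<^sup>2" by (simp add: power_mult_distrib)
  then have "sqrt (b\<^sup>2 - x\<^sup>2) \<le> b * y" using y0 b by (intro real_le_lsqrt) auto
  moreover have "- b * Im z = b * y - t"
    using im b by (simp add: y_def field_simps)
  ultimately show ?thesis unfolding I by simp
qed

lemma integral_reflect_shift:
  fixes f :: "real \<Rightarrow> real"
  assumes "\<And>S. continuous_on S f"
  shows "integral {a..b} (\<lambda>v. f (c - v)) = integral {c - b..c - a} f"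
proof -
  have "integral {a..b} (\<lambda>v. f (c - v)) = integral {-b..-a} (\<lambda>x. f (c - (- x)))"
    by (rule Henstock_Kurzweil_Integration.integral_reflect_real[symmetric])
  also have "\<dots> = integral {-b..-a} (f \<circ> (\<lambda>x. x + c))"
    by (simp only: o_def diff_minus_eq_add add.commute[of c])
  also have "\<dots> = integral {-b + c..-a + c} f"
    by (rule integral_shift) (rule assms)
  also have "{-b + c..-a + c} = {c - b..c - a}" by simp
  finally show ?thesis .
qed

text \<open>The substitution y = - b cos (2 pi v) runs through [-b, b] once for v in [0, 1/2]. The
  full turn in \<open>semicircle_poisson_circle\<close> covers it twice, which turns the factor 2 pi
  of the substitution into pi.\<close>

lemma semicircle_poisson_line:
  assumes b: "b > 0" and t: "t > 0" and x: "\<bar>x\<bar> \<le> b"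
  shows "integral {-b..b} (\<lambda>y. sqrt (b\<^sup>2 - y\<^sup>2) * (t / (t\<^sup>2 + (x - y)\<^sup>2))) \<ge> pi * (sqrt (b\<^sup>2 - x\<^sup>2) - t)"
proof -
  let ?k = "\<lambda>y. t / (t\<^sup>2 + (x - y)\<^sup>2)"
  let ?f = "\<lambda>y. sqrt (b\<^sup>2 - y\<^sup>2) * ?k y"
  let ?F = "\<lambda>v. (b * sin (2 * pi * v))\<^sup>2 * ?k (b * cos (2 * pi * v))"
  have nz: "t\<^sup>2 + y\<^sup>2 \<noteq> 0" for y using t by (simp add: sum_power2_eq_zero_iff)
  have contF: "continuous_on S ?F" for S :: "real set" using nz by (intro continuous_intros) auto
  have "((\<lambda>v. (2 * pi * b * sin (2 * pi * v)) *\<^sub>R ?f (- b * cos (2 * pi * v))) has_integral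
     integral {- b * cos (2 * pi * 0)..- b * cos (2 * pi * (1/2))} ?f) {0..1/2}"
  proof (rule has_integral_substitution[where c="-b" and d=b])
    show "(\<lambda>v. - b * cos (2 * pi * v)) ` {0..1 / 2} \<subseteq> {- b..b}"
    proof clarsimp
      fix v :: real
      have "\<bar>b * cos (2 * pi * v)\<bar> \<le> b * 1" unfolding abs_mult using b by (intro mult_mono) auto
      then show "b * cos (2 * pi * v) \<le> b \<and> - (b * cos (2 * pi * v)) \<le> b" by (auto simp: abs_le_iff)
    qed
    show "continuous_on {-b..b} ?f" using nz by (intro continuous_intros) auto
    show "((\<lambda>v. - b * cos (2 * pi * v)) has_real_derivative 2 * pi * b * sin (2 * pi * v)) (at v within {0..1/2})" for v
      by (auto intro!: derivative_eq_intros)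
  qed (use b in auto)
  then have "((\<lambda>v. (2 * pi * b * sin (2 * pi * v)) * ?f (- b * cos (2 * pi * v))) has_integral integral {-b..b} ?f) {0..1/2}"
    by simp
  then have "((\<lambda>v. 2 * pi * ?F (1/2 - v)) has_integral integral {-b..b} ?f) {0..1/2}"
  proof (rule has_integral_eq[rotated])
    fix v :: real assume v: "v \<in> {0..1/2}"
    have "sin (2 * pi * v) \<ge> 0" using v by (intro sin_ge_zero) (auto simp: field_simps)
    then have "sqrt (b\<^sup>2 - (- b * cos (2 * pi * v))\<^sup>2) = b * sin (2 * pi * v)"
      using b by (intro real_sqrt_unique) (auto simp: power_mult_distrib cos_squared_eq algebra_simps)
    moreover have "sin (2 * pi * (1/2 - v)) = sin (2 * pi * v)" "cos (2 * pi * (1/2 - v)) = - cos (2 * pi * v)"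
      by (simp_all add: right_diff_distrib sin_diff cos_diff)
    ultimately show "2 * pi * b * sin (2 * pi * v) * ?f (- b * cos (2 * pi * v)) = 2 * pi * ?F (1/2 - v)"
      by (simp add: power2_eq_square)
  qed
  then have "integral {0..1/2} (\<lambda>v. 2 * pi * ?F (1/2 - v)) = integral {-b..b} ?f"
    by (rule integral_unique)
  then have 1: "2 * pi * integral {0..1/2} (\<lambda>v. ?F (1/2 - v)) = integral {-b..b} ?f"
    by (subst (asm) Henstock_Kurzweil_Integration.integral_mult_right)
  have 2: "integral {0..1/2} (\<lambda>v. ?F (1/2 - v)) = integral {0..1/2} ?F"
    using integral_reflect_shift[OF contF, of 0 "1/2" "1/2"] by (simp only: diff_self diff_zero)
  have 3: "integral {1/2..1} ?F = integral {0..1/2} ?F"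
  proof -
    have "(\<lambda>v. ?F (1 - v)) = ?F"
      by (simp add: right_diff_distrib sin_diff cos_diff)
    moreover have "1 - 1/2 = (1/2::real)" by simp
    ultimately show ?thesis
      using integral_reflect_shift[OF contF, of 0 "1/2" 1] by (simp only: diff_zero)
  qed
  have 4: "integral {0..1} ?F = integral {0..1/2} ?F + integral {1/2..1} ?F"
    using contF by (intro Henstock_Kurzweil_Integration.integral_combine[symmetric] integrable_continuous_real) auto
  have "pi * (sqrt (b\<^sup>2 - x\<^sup>2) - t) \<le> pi * integral {0..1} ?F"
    by (intro mult_left_mono semicircle_poisson_circle[OF assms]) simp
  also have "\<dots> = 2 * pi * integral {0..1/2} ?F"
    unfolding 4 3 by (simp only: distrib_left mult_2 distrib_right)
  also have "\<dots> = integral {-b..b} ?f"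
    using 1 unfolding 2 .
  finally show ?thesis .
qed

section \<open>Smoothing of continuous densities\<close>

definition conv_pk :: "(real \<Rightarrow> real) \<Rightarrow> real \<Rightarrow> real \<Rightarrow> real" where
  "conv_pk E t x = integral {0..1} (\<lambda>z. E z * pk t (x - z))"

definition conv_lnk :: "(real \<Rightarrow> real) \<Rightarrow> real \<Rightarrow> real \<Rightarrow> real" where
  "conv_lnk E t y = integral {0..1} (\<lambda>x. E x * lnk t (x - y))"

lemma integral_swap_unit:
  fixes f :: "real \<Rightarrow> real \<Rightarrow> real"
  assumes "continuous_on UNIV (\<lambda>(x, y). f x y)"
  shows "integral {0..1} (\<lambda>x. integral {0..1} (f x)) = integral {0..1} (\<lambda>y. integral {0..1} (\<lambda>x. f x y))"
  using integral_swap_continuous[of 0 0 1 1 f] continuous_on_subset[OF assms, of "cbox (0,0) (1,1)"]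
  by simp

lemma continuous_on_compose_UNIV:
  assumes "continuous_on UNIV E" "continuous_on S g"
  shows "continuous_on S (\<lambda>x. E (g x))"
  by (rule continuous_on_compose2[OF assms]) auto

context
  fixes E :: "real \<Rightarrow> real"
  assumes E: "continuous_on UNIV E"
begin

lemma conv_lnk_has_derivative:
  assumes s: "s > 0"
  shows "((\<lambda>s. conv_lnk E s y) has_real_derivative - pi * (conv_pk E s y - integral {0..1} E)) (at s)"
proof -
  have cont: "continuous_on S (\<lambda>x. pk s (x - y))" for S
    using s by (intro continuous_intros) auto
  have "((\<lambda>s. integral (cbox 0 1) (\<lambda>x. E x * lnk s (x - y))) has_real_derivative
     integral (cbox 0 1) (\<lambda>x. E x * (- pi * (pk s (x - y) - 1)))) (at s within {0<..})"
  proof (rule leibniz_rule_field_derivative)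
    fix x t :: real assume "x \<in> {0<..}"
    then show "((\<lambda>x. E t * lnk x (t - y)) has_real_derivative E t * (- pi * (pk x (t - y) - 1))) (at x within {0<..})"
      by (intro DERIV_cmult DERIV_subset[OF lnk_has_derivative]) auto
  next
    fix x :: real assume "x \<in> {0<..}"
    then show "(\<lambda>t. E t * lnk x (t - y)) integrable_on cbox 0 1"
      by (intro integrable_continuous continuous_intros continuous_on_compose_UNIV[OF E]) auto
  next
    show "continuous_on ({0<..} \<times> cbox 0 1) (\<lambda>(x, t). E t * (- pi * (pk x (t - y) - 1)))"
      unfolding case_prod_beta
      by (intro continuous_intros continuous_on_compose_UNIV[OF E]) auto
  qed (use s in auto)
  then have "((\<lambda>s. conv_lnk E s y) has_real_derivative
     integral {0..1} (\<lambda>x. E x * (- pi * (pk s (x - y) - 1)))) (at s)"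
    using s by (simp add: conv_lnk_def at_within_open[of s "{0<..}"])
  moreover have "integral {0..1} (\<lambda>x. E x * (- pi * (pk s (x - y) - 1))) = - pi * (conv_pk E s y - integral {0..1} E)"
  proof -
    have "integral {0..1} (\<lambda>x. E x * (- pi * (pk s (x - y) - 1))) = integral {0..1} (\<lambda>x. - pi * (E x * pk s (x - y) - E x))"
      by (simp add: algebra_simps)
    also have "\<dots> = - pi * integral {0..1} (\<lambda>x. E x * pk s (x - y) - E x)"
      by (rule Henstock_Kurzweil_Integration.integral_mult_right)
    also have "integral {0..1} (\<lambda>x. E x * pk s (x - y) - E x) = integral {0..1} (\<lambda>x. E x * pk s (x - y)) - integral {0..1} E"
      by (intro Henstock_Kurzweil_Integration.integral_diff integrable_continuous_real continuous_intros cont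
            continuous_on_subset[OF E]) auto
    also have "(\<lambda>x. E x * pk s (x - y)) = (\<lambda>x. E x * pk s (y - x))"
      by (metis pk_minus minus_diff_eq)
    finally show ?thesis by (simp only: conv_pk_def)
  qed
  ultimately show ?thesis by simp
qed

lemma continuous_on_conv_pk:
  assumes "t > 0"
  shows "continuous_on UNIV (conv_pk E t)"
proof -
  have "continuous_on UNIV (\<lambda>x. integral (cbox 0 1) (\<lambda>z. E z * pk t (x - z)))"
    unfolding case_prod_beta using assms
    by (intro integral_continuous_on_param) (auto intro!: continuous_intros continuous_on_compose_UNIV[OF E] simp: case_prod_beta)
  then show ?thesis by (simp add: conv_pk_def[abs_def])
qed

lemma lnk_conv_conv_pk:
  assumes s: "s > 0" and t: "t > 0"
  shows "integral {0..1} (\<lambda>x. lnk s (x - y) * conv_pk E t x) = conv_lnk E (s + t) y"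
proof -
  have "integral {0..1} (\<lambda>x. lnk s (x - y) * conv_pk E t x)
    = integral {0..1} (\<lambda>x. integral {0..1} (\<lambda>z. lnk s (x - y) * (E z * pk t (x - z))))"
    unfolding conv_pk_def by (simp only: Henstock_Kurzweil_Integration.integral_mult_right)
  also have "\<dots> = integral {0..1} (\<lambda>z. integral {0..1} (\<lambda>x. lnk s (x - y) * (E z * pk t (x - z))))"
    using s t by (intro integral_swap_unit)
       (auto intro!: continuous_intros continuous_on_compose_UNIV[OF E] simp: case_prod_beta)
  also have "\<dots> = integral {0..1} (\<lambda>z. E z * integral {0..1} (\<lambda>x. lnk s (x - y) * pk t (x - z)))"
    by (simp only: Henstock_Kurzweil_Integration.integral_mult_right[symmetric] mult.left_commute)
  also have "\<dots> = conv_lnk E (s + t) y"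
    unfolding conv_lnk_def by (simp only: integral_unique[OF lnk_conv_pk[OF s t]])
  finally show ?thesis .
qed

lemma integral_conv_pk:
  assumes t: "t > 0"
  shows "integral {0..1} (conv_pk E t) = integral {0..1} E"
proof -
  have "(\<lambda>x. pk t (x - z)) = (\<lambda>x. pk t (z - x))" for z
    by (metis pk_minus minus_diff_eq)
  then have 1: "integral {0..1} (\<lambda>x. pk t (x - z)) = 1" for z
    by (simp only: integral_unique[OF integral_pk[OF t]])
  have "integral {0..1} (conv_pk E t) = integral {0..1} (\<lambda>x. integral {0..1} (\<lambda>z. E z * pk t (x - z)))"
    by (simp add: conv_pk_def[abs_def])
  also have "\<dots> = integral {0..1} (\<lambda>z. integral {0..1} (\<lambda>x. E z * pk t (x - z)))"
    using t by (intro integral_swap_unit)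
       (auto intro!: continuous_intros continuous_on_compose_UNIV[OF E] simp: case_prod_beta)
  also have "\<dots> = integral {0..1} (\<lambda>z. E z * integral {0..1} (\<lambda>x. pk t (x - z)))"
    by (simp only: Henstock_Kurzweil_Integration.integral_mult_right)
  also have "\<dots> = integral {0..1} E" by (simp only: 1 mult_1_right)
  finally show ?thesis .
qed

definition dual_density :: "real \<Rightarrow> real \<Rightarrow> real" where
  "dual_density t x = 1 - (E x - conv_pk E t x) / (pi * t)"

lemma continuous_on_dual_density: "t > 0 \<Longrightarrow> continuous_on S (dual_density t)"
  unfolding dual_density_def[abs_def]
  by (intro continuous_intros continuous_on_subset[OF E] continuous_on_subset[OF continuous_on_conv_pk]) auto

lemma integral_dual_density:
  assumes t: "t > 0" shows "integral {0..1} (dual_density t) = 1"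
proof -
  have "integral {0..1} (\<lambda>x. 1 - (1 / (pi * t)) * (E x - conv_pk E t x))
    = 1 - (1 / (pi * t)) * (integral {0..1} E - integral {0..1} (conv_pk E t))"
    using t by (subst Henstock_Kurzweil_Integration.integral_diff)
     (auto intro!: integrable_continuous_real continuous_intros continuous_on_subset[OF E]
       continuous_on_subset[OF continuous_on_conv_pk] Henstock_Kurzweil_Integration.integral_diff)
  then show ?thesis using integral_conv_pk[OF t] by (simp add: dual_density_def[abs_def])
qed

text \<open>Convolving the kernel at height s with the Poisson difference quotient gives a
  difference quotient of \<open>conv_lnk E\<close> between s and s + t. By the mean value theorem it
  is governed by the Poisson integral at some height u in between, where \<open>super\<close>
  applies with loss pi u \<le> pi (s + t).\<close>

lemma integral_lnk_dual_density:
  assumes s: "s > 0" and t: "t > 0"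
    and super: "\<And>t. t > 0 \<Longrightarrow> conv_pk E t y \<ge> E y - pi * t"
  shows "integral {0..1} (\<lambda>x. lnk s (x - y) * dual_density t x) \<le> - (E y - integral {0..1} E - pi * (s + t))"
proof -
  let ?l = "\<lambda>x. lnk s (x - y)"
  have [continuous_intros]: "continuous_on S ?l" "continuous_on S (conv_pk E t)" "continuous_on S E" for S
    using s t by (auto intro!: continuous_intros continuous_on_subset[OF E] continuous_on_subset[OF continuous_on_conv_pk])
  have "integral {0..1} (\<lambda>x. ?l x * dual_density t x)
     = integral {0..1} (\<lambda>x. ?l x - (1 / (pi * t)) * (E x * ?l x - ?l x * conv_pk E t x))"
    using t by (intro integral_cong) (simp add: dual_density_def field_simps)
  also have "\<dots> = integral {0..1} ?l - integral {0..1} (\<lambda>x. (1 / (pi * t)) * (E x * ?l x - ?l x * conv_pk E t x))"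
    by (intro Henstock_Kurzweil_Integration.integral_diff integrable_continuous_real continuous_intros)
  also have "integral {0..1} (\<lambda>x. (1 / (pi * t)) * (E x * ?l x - ?l x * conv_pk E t x))
     = (1 / (pi * t)) * integral {0..1} (\<lambda>x. E x * ?l x - ?l x * conv_pk E t x)"
    by (rule Henstock_Kurzweil_Integration.integral_mult_right)
  also have "integral {0..1} (\<lambda>x. E x * ?l x - ?l x * conv_pk E t x) = conv_lnk E s y - conv_lnk E (s + t) y"
    unfolding lnk_conv_conv_pk[OF s t, symmetric] conv_lnk_def[of E s]
    by (intro Henstock_Kurzweil_Integration.integral_diff integrable_continuous_real continuous_intros)
  also have "integral {0..1} ?l = 0"
    by (rule integral_unique[OF integral_lnk[OF s]])
  finally have eq: "integral {0..1} (\<lambda>x. ?l x * dual_density t x) = - (1 / (pi * t)) * (conv_lnk E s y - conv_lnk E (s + t) y)"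
    by simp
  obtain u where u: "s < u" "u < s + t"
     "conv_lnk E (s + t) y - conv_lnk E s y = (s + t - s) * (- pi * (conv_pk E u y - integral {0..1} E))"
    using MVT2[of s "s + t" "\<lambda>s. conv_lnk E s y" "\<lambda>u. - pi * (conv_pk E u y - integral {0..1} E)"]
      conv_lnk_has_derivative s t by auto
  have "integral {0..1} (\<lambda>x. ?l x * dual_density t x) = - (conv_pk E u y - integral {0..1} E)"
    unfolding eq using u(3) t by (simp add: field_simps)
  moreover have "conv_pk E u y \<ge> E y - pi * (s + t)"
  proof -
    have "pi * u \<le> pi * (s + t)" using u by simp
    then show ?thesis using super[of u] u s by linarith
  qed
  ultimately show ?thesis by simp
qed

end

section \<open>The test function of an arc\<close>

lemma periodic_of_int:
  assumes "\<And>x. f (x + 1) = (f x :: 'a)"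
  shows "f (x + of_int n) = f (x::real)"
proof (induction n rule: int_induct[where k=0])
  case (step1 i)
  then show ?case using assms[of "x + of_int i"] by (simp add: add.assoc)
next
  case (step2 i)
  then show ?case using assms[of "x + of_int (i - 1)"] by simp
qed simp

lemma integral_periodic:
  fixes f :: "real \<Rightarrow> real"
  assumes per: "\<And>x. f (x + 1) = f x" and cont: "continuous_on UNIV f"
  shows "integral {c..c + 1} f = integral {0..1} f"
proof -
  have c: "continuous_on S f" for S using cont by (rule continuous_on_subset) simp
  have int: "f integrable_on {u..v}" for u v by (intro integrable_continuous_real c)
  define p where "p = frac c"
  have p: "0 \<le> p" "p \<le> 1" by (auto simp: p_def frac_lt_1 less_imp_le)
  have "integral {c..c + 1} f = integral {p + of_int \<lfloor>c\<rfloor>..(p + 1) + of_int \<lfloor>c\<rfloor>} f"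
    by (simp add: p_def frac_def)
  also have "\<dots> = integral {p..p + 1} (f \<circ> (\<lambda>x. x + of_int \<lfloor>c\<rfloor>))"
    by (rule integral_shift[symmetric]) (rule c)
  also have "\<dots> = integral {p..p + 1} f"
    using periodic_of_int[of f, OF per] by (simp add: o_def)
  also have "\<dots> = integral {p..1} f + integral {0 + 1..p + 1} f"
    using Henstock_Kurzweil_Integration.integral_combine[of p 1 "p + 1" f] int p by simp
  also have "integral {0 + 1..p + 1} f = integral {0..p} (f \<circ> (\<lambda>x. x + 1))"
    by (rule integral_shift[symmetric]) (rule c)
  also have "\<dots> = integral {0..p} f"
    by (simp add: o_def per)
  also have "integral {p..1} f + integral {0..p} f = integral {0..1} f"
    using Henstock_Kurzweil_Integration.integral_combine[of 0 p 1 f] int p by simp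
  finally show ?thesis .
qed

section \<open>Half-ellipses and the suprema of their translates\<close>

definition semicirc :: "real \<Rightarrow> real \<Rightarrow> real" where
  "semicirc b x = pi * sqrt (max 0 (b\<^sup>2 - x\<^sup>2))"

lemma continuous_on_semicirc [continuous_intros]:
  "continuous_on S f \<Longrightarrow> continuous_on S (\<lambda>x. semicirc b (f x))"
  unfolding semicirc_def by (intro continuous_intros)

lemma semicirc_nonneg [simp]: "semicirc b x \<ge> 0"
  by (simp add: semicirc_def)

lemma semicirc_0 [simp]: "b \<ge> 0 \<Longrightarrow> semicirc b 0 = pi * b"
  by (simp add: semicirc_def)

lemma semicirc_antimono: "\<bar>x\<bar> \<le> \<bar>y\<bar> \<Longrightarrow> semicirc b y \<le> semicirc b x"
  unfolding semicirc_def
  by (intro mult_left_mono real_sqrt_le_mono max.mono) (auto simp: abs_le_square_iff)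

text \<open>Over [0, b] the graph bounds a quarter of an ellipse with half-axes b and pi b; b \<le>
  1 keeps it inside the unit interval.\<close>

lemma integral_semicirc:
  assumes b: "0 < b" "b \<le> 1"
  shows "integral {0..1} (semicirc b) = (pi * b)\<^sup>2 / 4"
proof -
  let ?F = "\<lambda>x. pi * (x * sqrt (b\<^sup>2 - x\<^sup>2) + b\<^sup>2 * arcsin (x / b)) / 2"
  have "((\<lambda>x. pi * sqrt (b\<^sup>2 - x\<^sup>2)) has_integral ?F b - ?F 0) {0..b}"
  \<comment> \<open>The version with interior derivatives is chosen because arcsin (x / b) is not
    differentiable at x = b.\<close>
  proof (rule fundamental_theorem_of_calculus_interior)
    show "continuous_on {0..b} ?F"
      using b by (intro continuous_intros) (auto simp: field_simps)
    fix x assume x: "x \<in> {0<..<b}"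
    define r where "r = sqrt (b\<^sup>2 - x\<^sup>2)"
    have pos: "b\<^sup>2 - x\<^sup>2 > 0" using x by (simp add: power_strict_mono)
    have r: "r > 0" "r\<^sup>2 = b\<^sup>2 - x\<^sup>2" using pos by (simp_all add: r_def)
    have sq: "sqrt (1 - (x / b)\<^sup>2) = r / b"
    proof -
      have "1 - (x / b)\<^sup>2 = (b\<^sup>2 - x\<^sup>2) / b\<^sup>2" using b by (simp add: field_simps)
      then show ?thesis using b by (simp add: r_def real_sqrt_divide)
    qed
    have "(?F has_real_derivative pi * ((1 * r + x * (- (2 * x) * (inverse r / 2))) + b\<^sup>2 * ((1 / b) * inverse (r / b))) / 2) (at x)"
      using x pos b unfolding r_def sq[unfolded r_def, symmetric]
      by (auto intro!: derivative_eq_intros simp: field_simps)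
    moreover have "pi * ((1 * r + x * (- (2 * x) * (inverse r / 2))) + b\<^sup>2 * ((1 / b) * inverse (r / b))) / 2 = pi * r"
    proof -
      have "(1 * r + x * (- (2 * x) * (inverse r / 2))) + b\<^sup>2 * ((1 / b) * inverse (r / b)) = r + (b\<^sup>2 - x\<^sup>2) / r"
        using r b by (simp add: field_simps power2_eq_square)
      also have "\<dots> = 2 * r" unfolding r(2)[symmetric] using r(1) by (simp add: power2_eq_square)
      finally show ?thesis by simp
    qed
    ultimately have "(?F has_real_derivative pi * r) (at x)" by (simp only:)
    then show "(?F has_vector_derivative pi * sqrt (b\<^sup>2 - x\<^sup>2)) (at x)"
      unfolding has_real_derivative_iff_has_vector_derivative r_def .
  qed (use b in simp)
  then have "((\<lambda>x. pi * sqrt (b\<^sup>2 - x\<^sup>2)) has_integral (pi * b)\<^sup>2 / 4) {0..b}"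
    using b by (simp add: power2_eq_square mult_ac)
  then have "(semicirc b has_integral (pi * b)\<^sup>2 / 4) {0..b}"
    by (rule has_integral_eq[rotated]) (auto simp: semicirc_def max_def power_mono)
  moreover have "(semicirc b has_integral 0) {b..1}"
    by (rule has_integral_eq[OF _ has_integral_0])
       (use b in \<open>auto simp: semicirc_def max_def power_mono\<close>)
  ultimately have "(semicirc b has_integral (pi * b)\<^sup>2 / 4 + 0) {0..1}"
    by (rule has_integral_combine[rotated 2]) (use b in auto)
  then show ?thesis by (simp add: integral_unique)
qed

text \<open>Since \<open>semicirc b\<close> decreases in |x|, its value at the distance to a closed
  nonempty A is the supremum of its translates by points of A. In this form continuity is
  immediate.\<close>

definition bump :: "real \<Rightarrow> real set \<Rightarrow> real \<Rightarrow> real" where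
  "bump b A x = semicirc b (infdist x A)"

lemma continuous_on_bump: "continuous_on S (bump b A)"
  unfolding bump_def[abs_def] by (intro continuous_intros)

lemma infdist_periodic:
  fixes A :: "real set"
  assumes "\<And>x. x + 1 \<in> A \<longleftrightarrow> x \<in> A"
  shows "infdist (x + 1) A = infdist x A"
proof -
  have "A = (+) 1 ` A"
  proof
    show "A \<subseteq> (+) 1 ` A" 
    proof
      fix y assume "y \<in> A"
      then have "y - 1 \<in> A" using assms[of "y - 1"] by simp
      then show "y \<in> (+) 1 ` A" by (auto intro!: image_eqI[where x="y - 1"])
    qed
  qed (use assms in \<open>auto simp: add.commute\<close>)
  then have "(\<lambda>a. dist (x + 1) a) ` A = (\<lambda>a. dist (x + 1) (1 + a)) ` A"
    by (metis image_image)
  then have "(INF a\<in>A. dist (x + 1) a) = (INF a\<in>A. dist x a)"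
    by (simp add: dist_real_def)
  then show ?thesis by (simp add: infdist_def)
qed

text \<open>At x the supremum is attained by the translate centred at a nearest point c of A, and
  everywhere it lies above that translate, so the estimate for one half-ellipse carries over.
  Because b \<le> 1/2, the base [c - b, c + b] fits into one period.\<close>

lemma bump_super:
  assumes A: "closed A" "A \<noteq> {}" "\<And>x. x + 1 \<in> A \<longleftrightarrow> x \<in> A"
    and b: "0 < b" "b \<le> 1/2" and t: "t > 0"
  shows "conv_pk (bump b A) t x \<ge> bump b A x - pi * t"
proof -
  let ?g = "\<lambda>z. bump b A z * pk t (x - z)"
  have contg: "continuous_on S ?g" for S
    using t by (intro continuous_intros continuous_on_bump) auto
  have nonneg: "?g z \<ge> 0" for z
    using pk_pos[OF t] by (simp add: bump_def less_imp_le)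
  obtain c where c: "c \<in> A" "infdist x A = \<bar>x - c\<bar>"
    using infdist_attains_inf[OF A(1,2), of x] by (auto simp: dist_real_def)
  show ?thesis
  proof (cases "\<bar>x - c\<bar> \<le> b")
    case False
    then have "b\<^sup>2 - (x - c)\<^sup>2 \<le> 0" using b by (simp add: abs_le_square_iff[symmetric])
    then have "bump b A x = 0" by (simp add: bump_def semicirc_def c)
    moreover have "conv_pk (bump b A) t x \<ge> 0"
      unfolding conv_pk_def by (intro integral_nonneg integrable_continuous_real contg nonneg)
    ultimately show ?thesis using t by (simp add: less_imp_le order_trans[of _ 0])
  next
    case True
    let ?k = "\<lambda>y. sqrt (b\<^sup>2 - y\<^sup>2) * (t / (t\<^sup>2 + ((x - c) - y)\<^sup>2))"
    have nz: "t\<^sup>2 + y\<^sup>2 \<noteq> 0" for y using t by (simp add: sum_power2_eq_zero_iff)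
    have contk: "continuous_on S (\<lambda>z. ?k (z - c))" "continuous_on S ?k" for S
      using nz by (auto intro!: continuous_intros)
    have per: "?g (z + 1) = ?g z" for z
      using pk_plus_1[of t "x - z - 1"] infdist_periodic[OF A(3), of z] by (simp add: bump_def diff_diff_eq)
    have "bump b A x - pi * t = pi * (sqrt (b\<^sup>2 - (x - c)\<^sup>2) - t)"
      using True b by (simp add: bump_def semicirc_def c max_def abs_le_square_iff[symmetric] right_diff_distrib)
    also have "\<dots> \<le> integral {-b..b} ?k"
      using semicircle_poisson_line[OF b(1) t True] .
    also have "\<dots> = integral {-b..b} ((\<lambda>z. ?k (z - c)) \<circ> (\<lambda>y. y + c))"
      by (simp only: o_def add_diff_cancel_right')
    also have "\<dots> = integral {-b + c..b + c} (\<lambda>z. ?k (z - c))"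
      by (rule integral_shift) (rule contk)
    also have "\<dots> \<le> integral {-b + c..b + c} ?g"
    proof (rule integral_le)
      fix z assume z: "z \<in> {-b + c..b + c}"
      have 1: "pi * sqrt (b\<^sup>2 - (z - c)\<^sup>2) \<le> bump b A z"
      proof -
        have "infdist z A \<le> \<bar>z - c\<bar>" using infdist_le[OF c(1), of z] by (simp add: dist_real_def)
        then have "semicirc b (z - c) \<le> bump b A z"
          unfolding bump_def by (intro semicirc_antimono) (simp add: infdist_nonneg)
        moreover have "pi * sqrt (b\<^sup>2 - (z - c)\<^sup>2) \<le> semicirc b (z - c)"
          unfolding semicirc_def by (intro mult_left_mono) auto
        ultimately show ?thesis by linarith
      qed
      have "\<bar>z - c\<bar> \<le> b" using z by auto
      then have sq0: "b\<^sup>2 - (z - c)\<^sup>2 \<ge> 0" using b by (simp add: abs_le_square_iff[symmetric])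
      have "?k (z - c) \<le> sqrt (b\<^sup>2 - (z - c)\<^sup>2) * (pi * pk t (x - z))"
        using pk_ge_line[OF t, of "x - z"] sq0 by (intro mult_left_mono) auto
      also have "\<dots> = (pi * sqrt (b\<^sup>2 - (z - c)\<^sup>2)) * pk t (x - z)" by simp
      also have "\<dots> \<le> ?g z"
        using 1 pk_pos[OF t, of "x - z"] by (intro mult_right_mono) auto
      finally show "?k (z - c) \<le> ?g z" .
    qed (intro integrable_continuous_real contk contg)+
    also have "\<dots> \<le> integral {c - 1/2..c - 1/2 + 1} ?g"
      using nonneg b by (intro integral_subset_le integrable_continuous_real contg) auto
    also have "\<dots> = integral {0..1} ?g"
      by (rule integral_periodic[OF per contg])
    finally show ?thesis by (simp add: conv_pk_def)
  qed
qed

text \<open>The periodic lift of an arc to the line. The shape of a sum set, integers plus a compact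
  interval, makes closedness an instance of \<open>closed_compact_sums\<close>.\<close>

definition lifted_arc :: "real \<Rightarrow> real \<Rightarrow> real set" where
  "lifted_arc a L = (\<Union>n\<in>\<int>. \<Union>y\<in>{a..a + L}. {n + y})"

lemma closed_lifted_arc: "closed (lifted_arc a L)"
  unfolding lifted_arc_def by (rule closed_compact_sums) simp_all

lemma lifted_arc_iff: "x \<in> lifted_arc a L \<longleftrightarrow> (\<exists>n::int. x - of_int n \<in> {a..a + L})"
proof
  assume "x \<in> lifted_arc a L"
  then obtain m y where m: "m \<in> \<int>" "y \<in> {a..a + L}" "x = m + y"
    unfolding lifted_arc_def by blast
  from m(1) obtain n where "m = of_int n" by (rule Ints_cases)
  with m have "x - of_int n \<in> {a..a + L}" by simp
  then show "\<exists>n::int. x - of_int n \<in> {a..a + L}" ..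
next
  assume "\<exists>n::int. x - of_int n \<in> {a..a + L}"
  then obtain n :: int where n: "x - of_int n \<in> {a..a + L}" ..
  show "x \<in> lifted_arc a L" unfolding lifted_arc_def
    by (rule UN_I[of "of_int n"], simp, rule UN_I[OF n], simp)
qed

lemma lifted_arc_plus_1: "x + 1 \<in> lifted_arc a L \<longleftrightarrow> x \<in> lifted_arc a L"
proof
  assume "x + 1 \<in> lifted_arc a L"
  then obtain n :: int where "x + 1 - of_int n \<in> {a..a + L}" unfolding lifted_arc_iff ..
  then have "x - of_int (n - 1) \<in> {a..a + L}" by simp
  then show "x \<in> lifted_arc a L" unfolding lifted_arc_iff ..
next
  assume "x \<in> lifted_arc a L"
  then obtain n :: int where "x - of_int n \<in> {a..a + L}" unfolding lifted_arc_iff ..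
  then have "x + 1 - of_int (n + 1) \<in> {a..a + L}" by simp
  then show "x + 1 \<in> lifted_arc a L" unfolding lifted_arc_iff ..
qed

lemma arc_subset_lifted_arc: "arc a L \<subseteq> lifted_arc a L"
proof
  fix x assume "x \<in> arc a L"
  then have "frac (x - a) \<le> L" by (simp add: arc_def)
  moreover have "x - of_int \<lfloor>x - a\<rfloor> = a + frac (x - a)" by (simp add: frac_def)
  ultimately have "x - of_int \<lfloor>x - a\<rfloor> \<in> {a..a + L}" by simp
  then show "x \<in> lifted_arc a L" unfolding lifted_arc_iff ..
qed

lemma lifted_arc_nonempty:
  assumes "L \<ge> 0" shows "lifted_arc a L \<noteq> {}"
proof -
  have "a - of_int 0 \<in> {a..a + L}" using assms by simp
  then have "a \<in> lifted_arc a L" unfolding lifted_arc_iff ..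
  then show ?thesis by blast
qed

text \<open>On the arc the height is at most pi b. Over the gap [a + L, a + 1] a nearest point of
  the lifted arc lies to the left of a + L or to the right of a + 1, so the function is below one of
  two quarter-ellipses that descend from the ends of the gap.\<close>

lemma integral_bump_le:
  assumes b: "0 < b" "b \<le> 1/2" and L: "0 \<le> L" "L < 1"
  shows "integral {0..1} (bump b (lifted_arc a L)) \<le> L * (pi * b) + (pi * b)\<^sup>2 / 2"
proof -
  let ?A = "lifted_arc a L"
  let ?D = "bump b ?A"
  have ne: "?A \<noteq> {}" using L(1) by (rule lifted_arc_nonempty)
  have int: "?D integrable_on {u..v}" for u v
    by (intro integrable_continuous_real continuous_on_bump)
  have per: "?D (x + 1) = ?D x" for x
    using infdist_periodic[OF lifted_arc_plus_1] by (simp add: bump_def)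
  have cs: "continuous_on S (\<lambda>x. semicirc b (x - (a + L)))" "continuous_on S (\<lambda>x. semicirc b (a + 1 - x))" "continuous_on S (semicirc b)" for S
    unfolding semicirc_def[abs_def] by (intro continuous_intros)+
  have le: "integral {0..1 - L} (semicirc b) \<le> (pi * b)\<^sup>2 / 4"
  proof -
    have "integral {0..1 - L} (semicirc b) \<le> integral {0..1} (semicirc b)"
      using L by (intro integral_subset_le integrable_continuous_real cs) auto
    then show ?thesis using integral_semicirc[of b] b by simp
  qed
  have "integral {0..1} ?D = integral {a..a + 1} ?D"
    by (rule integral_periodic[symmetric, OF per continuous_on_bump])
  also have "\<dots> = integral {a..a + L} ?D + integral {a + L..a + 1} ?D"
    using L int by (intro Henstock_Kurzweil_Integration.integral_combine[symmetric]) auto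
  also have "integral {a..a + L} ?D \<le> integral {a..a + L} (\<lambda>x. pi * b)"
  proof (intro integral_le int)
    fix x
    have "?D x \<le> semicirc b 0" unfolding bump_def by (rule semicirc_antimono) simp
    then show "?D x \<le> pi * b" using b by simp
  qed auto
  also have "integral {a..a + L} (\<lambda>x. pi * b) = L * (pi * b)" using L by simp
  also have "integral {a + L..a + 1} ?D \<le> integral {a + L..a + 1} (\<lambda>x. semicirc b (x - (a + L)) + semicirc b (a + 1 - x))"
  proof (intro integral_le int integrable_continuous_real continuous_on_add cs)
    fix x assume x: "x \<in> {a + L..a + 1}"
    obtain c where c: "c \<in> ?A" "infdist x ?A = \<bar>x - c\<bar>"
      using infdist_attains_inf[OF closed_lifted_arc ne, of x] by (auto simp: dist_real_def)
    from c(1) obtain n :: int where "c - of_int n \<in> {a..a + L}" unfolding lifted_arc_iff ..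
    then have n: "a + of_int n \<le> c" "c \<le> a + L + of_int n" by auto
    have D: "?D x = semicirc b (x - c)" unfolding bump_def c semicirc_def by simp
    show "?D x \<le> semicirc b (x - (a + L)) + semicirc b (a + 1 - x)"
    proof (cases "n \<le> 0")
      case True
      then have "(of_int n :: real) \<le> 0" by simp
      then have "c \<le> a + L" using n by linarith
      then have "semicirc b (x - c) \<le> semicirc b (x - (a + L))" using x by (intro semicirc_antimono) auto
      then show ?thesis using D semicirc_nonneg[of b "a + 1 - x"] by linarith
    next
      case False
      then have "(of_int n :: real) \<ge> 1" by simp
      then have "c \<ge> a + 1" using n by linarith
      then have "semicirc b (x - c) \<le> semicirc b (a + 1 - x)" using x by (intro semicirc_antimono) auto
      then show ?thesis using D semicirc_nonneg[of b "x - (a + L)"] by linarith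
    qed
  qed
  also have "\<dots> = integral {a + L..a + 1} (\<lambda>x. semicirc b (x - (a + L))) + integral {a + L..a + 1} (\<lambda>x. semicirc b (a + 1 - x))"
    by (intro Henstock_Kurzweil_Integration.integral_add integrable_continuous_real cs)
  also have "integral {a + L..a + 1} (\<lambda>x. semicirc b (a + 1 - x)) = integral {0..1 - L} (semicirc b)"
  proof -
    have "a + 1 - (a + 1) = 0" "a + 1 - (a + L) = 1 - L" by simp_all
    then show ?thesis
      using integral_reflect_shift[OF cs(3), of "a + L" "a + 1" "a + 1"] by (simp only:)
  qed
  also have "integral {a + L..a + 1} (\<lambda>x. semicirc b (x - (a + L))) = integral {0..1 - L} (semicirc b)"
  proof -
    have "0 + (a + L) = a + L" "1 - L + (a + L) = a + 1" by simp_all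
    moreover have "(\<lambda>x. semicirc b (x - (a + L))) \<circ> (\<lambda>x. x + (a + L)) = semicirc b"
      by (simp add: o_def)
    ultimately show ?thesis
      using integral_shift[of 0 "a + L" "1 - L" "\<lambda>x. semicirc b (x - (a + L))", OF cs(1)] by (simp only:)
  qed
  finally show ?thesis using le by simp
qed

section \<open>The upper bound\<close>

lemma den_le_4: "t \<ge> 0 \<Longrightarrow> den t x \<le> 4"
proof -
  assume "t \<ge> 0"
  then have r: "exp (- 2 * pi * t) \<le> 1" by simp
  have "cmod (1 - zp t x) \<le> 1 + cmod (zp t x)" using norm_triangle_ineq4[of 1 "zp t x"] by simp
  also have "\<dots> \<le> 2" using r by (simp add: norm_zp)
  finally have "(cmod (1 - zp t x))\<^sup>2 \<le> 2\<^sup>2" by (intro power_mono) auto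
  then show ?thesis by (simp add: den_eq)
qed

lemma ln_4: "ln 4 = 2 * ln (2::real)"
  using ln_realpow[of 2 2] by simp

lemma lnk_ge: "t > 0 \<Longrightarrow> lnk t x + ln 2 \<ge> 0"
proof -
  assume t: "t > 0"
  have "ln (den t x) \<le> ln 4" using den_pos[OF t] den_le_4[of t x] t by simp
  then show ?thesis by (simp add: lnk_def ln_4)
qed

lemma den_0: "den 0 x = (2 * sin (pi * x))\<^sup>2"
proof -
  have "cos (2 * pi * x) = 1 - 2 * (sin (pi * x))\<^sup>2"
    using cos_double_sin[of "pi * x"] by (simp add: mult.assoc)
  then show ?thesis by (simp add: den_def power2_eq_square)
qed

lemma Wshift_eq_lnk_0:
  assumes "sin (pi * x) \<noteq> 0"
  shows "Wshift x = ennreal (lnk 0 x + ln 2)"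
proof -
  have "ln ((2 * sin (pi * x))\<^sup>2) = 2 * ln \<bar>2 * sin (pi * x)\<bar>"
    using assms by (subst power2_abs[symmetric], subst ln_realpow) auto
  then show ?thesis using assms by (simp add: Wshift_def lnk_def den_0)
qed

text \<open>With r = exp (- 2 pi t) one has \<open>den t x - r * den 0 x = (1 - r)^2\<close>, and
  taking half the logarithm of r costs pi t. This supplies the continuous minorant of W for the
  sharpness construction.\<close>

lemma Wshift_ge:
  assumes t: "t > 0"
  shows "ennreal (lnk t x + ln 2 - pi * t) \<le> Wshift x"
proof (cases "sin (pi * x) = 0")
  case True then show ?thesis by (simp add: Wshift_def)
next
  case False
  let ?r = "exp (- 2 * pi * t)"
  have pos: "den 0 x > 0" unfolding den_0 using False by simp
  have "den t x - ?r * den 0 x = (1 - ?r)\<^sup>2"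
    by (simp add: den_def power2_eq_square algebra_simps)
  then have "?r * den 0 x \<le> den t x" by (metis diff_ge_0_iff_ge zero_le_power2)
  then have "ln (?r * den 0 x) \<le> ln (den t x)" using pos den_pos[OF t] by simp
  then have "- 2 * pi * t + ln (den 0 x) \<le> ln (den t x)" using pos by (simp add: ln_mult)
  then have "lnk t x + ln 2 - pi * t \<le> lnk 0 x + ln 2" by (simp add: lnk_def)
  then show ?thesis unfolding Wshift_eq_lnk_0[OF False] by (rule ennreal_leI)
qed

lemma tendsto_lnk:
  assumes "f \<longlonglongrightarrow> t" "den t x > 0"
  shows "(\<lambda>n. lnk (f n) x) \<longlonglongrightarrow> lnk t x"
  unfolding lnk_def using assms unfolding den_def by (intro tendsto_intros) auto

lemma measurable_Wshift [measurable]: "Wshift \<in> borel_measurable borel"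
  unfolding Wshift_def[abs_def] by measurable

lemma measurable_lnk [measurable]: "t > 0 \<Longrightarrow> lnk t \<in> borel_measurable borel"
  by (intro borel_measurable_continuous_onI continuous_intros) auto

lemma measurable_pk [measurable]: "t > 0 \<Longrightarrow> pk t \<in> borel_measurable borel"
  by (intro borel_measurable_continuous_onI continuous_intros) auto

text \<open>The limit s -> 0 of \<open>lnk_conv_pk\<close>. Fatou's lemma gives just the inequality,
  in the direction that is wanted; pointwise convergence is established off the integer translates
  of y, a null set.\<close>

lemma Wshift_conv_pk_le:
  assumes t: "t > 0"
  shows "(\<integral>\<^sup>+ x. ennreal (pk t (x - z)) * Wshift (x - y) * indicator {0..1} x \<partial>lborel) \<le> ennreal (lnk t (z - y) + ln 2)"
proof -
  define s where "s n = inverse (real (Suc n))" for n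
  have s: "s n > 0" for n by (simp add: s_def)
  have s0: "s \<longlonglongrightarrow> 0" unfolding s_def by (rule LIMSEQ_inverse_real_of_nat)
  have [measurable]: "lnk (s n) \<in> borel_measurable borel" "pk t \<in> borel_measurable borel" for n
    using measurable_lnk[OF s] measurable_pk[OF t] by auto
  let ?u = "\<lambda>n x. ennreal ((lnk (s n) (x - y) + ln 2) * pk t (x - z)) * indicator {0..1} x"
  have int: "(\<integral>\<^sup>+ x. ?u n x \<partial>lborel) = ennreal (lnk (s n + t) (z - y) + ln 2)" for n
  proof (rule nn_integral_has_integral_lebesgue')
    show "0 \<le> (lnk (s n) (x - y) + ln 2) * pk t (x - z)" for x
      using lnk_ge[OF s, of n "x - y"] pk_pos[OF t, of "x - z"] by simp
    have "((\<lambda>x. pk t (x - z)) has_integral 1) {0..1}"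
      using integral_pk[OF t, of z] by (metis (no_types, lifting) ext pk_minus minus_diff_eq)
    then have "((\<lambda>x. lnk (s n) (x - y) * pk t (x - z) + ln 2 * pk t (x - z)) has_integral lnk (s n + t) (z - y) + ln 2 * 1) {0..1}"
      by (intro has_integral_add has_integral_mult_right lnk_conv_pk s t)
    then show "((\<lambda>x. (lnk (s n) (x - y) + ln 2) * pk t (x - z)) has_integral lnk (s n + t) (z - y) + ln 2) {0..1}"
      by (simp add: distrib_right)
  qed
  have lim: "AE x in lborel. (\<lambda>n. ?u n x) \<longlonglongrightarrow> ennreal (pk t (x - z)) * Wshift (x - y) * indicator {0..1} x"
  proof (rule AE_mp[OF AE_not_in])
    show "(\<lambda>n. of_int n + y) ` (UNIV :: int set) \<in> null_sets lborel"
      by (intro countable_imp_null_set_lborel) auto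
    show "AE x in lborel. x \<notin> range (\<lambda>n. of_int n + y) \<longrightarrow> (\<lambda>n. ?u n x) \<longlonglongrightarrow> ennreal (pk t (x - z)) * Wshift (x - y) * indicator {0..1} x"
    proof (intro AE_I2 impI)
      fix x assume x: "x \<notin> range (\<lambda>n::int. of_int n + y)"
      have ne: "sin (pi * (x - y)) \<noteq> 0"
      proof
        assume "sin (pi * (x - y)) = 0"
        then obtain i :: int where "pi * (x - y) = of_int i * pi" by (auto simp: sin_zero_iff_int2)
        then have "x = of_int i + y" by simp
        then show False using x by blast
      qed
      have "(\<lambda>n. lnk (s n) (x - y)) \<longlonglongrightarrow> lnk 0 (x - y)"
        using ne by (intro tendsto_lnk s0) (simp add: den_0)
      then have "(\<lambda>n. ennreal ((lnk (s n) (x - y) + ln 2) * pk t (x - z))) \<longlonglongrightarrow> ennreal ((lnk 0 (x - y) + ln 2) * pk t (x - z))"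
        by (intro tendsto_intros tendsto_ennrealI)
      moreover have "ennreal ((lnk 0 (x - y) + ln 2) * pk t (x - z)) = ennreal (pk t (x - z)) * Wshift (x - y)"
        unfolding Wshift_eq_lnk_0[OF ne] using pk_pos[OF t, of "x - z"]
        by (simp add: ennreal_mult' mult.commute)
      ultimately show "(\<lambda>n. ?u n x) \<longlonglongrightarrow> ennreal (pk t (x - z)) * Wshift (x - y) * indicator {0..1} x"
        by (cases "x \<in> {0..1}") auto
    qed
  qed
  have "(\<integral>\<^sup>+ x. ennreal (pk t (x - z)) * Wshift (x - y) * indicator {0..1} x \<partial>lborel)
      = (\<integral>\<^sup>+ x. liminf (\<lambda>n. ?u n x) \<partial>lborel)"
  proof (rule nn_integral_cong_AE)
    show "AE x in lborel. ennreal (pk t (x - z)) * Wshift (x - y) * indicator {0..1} x = liminf (\<lambda>n. ?u n x)"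
      using lim by eventually_elim (metis lim_imp_Liminf sequentially_bot)
  qed
  also have "\<dots> \<le> liminf (\<lambda>n. \<integral>\<^sup>+ x. ?u n x \<partial>lborel)"
    by (rule nn_integral_liminf) measurable
  also have "\<dots> = ennreal (lnk t (z - y) + ln 2)"
  proof (rule lim_imp_Liminf[OF sequentially_bot])
    have "(\<lambda>n. s n + t) \<longlonglongrightarrow> 0 + t" by (intro tendsto_intros s0)
    then show "(\<lambda>n. \<integral>\<^sup>+ x. ?u n x \<partial>lborel) \<longlonglongrightarrow> ennreal (lnk t (z - y) + ln 2)"
      unfolding int using den_pos[OF t]
      by (intro tendsto_ennrealI tendsto_intros tendsto_lnk) auto
  qed
  finally show ?thesis .
qed

text \<open>Take logarithms in 1 - r \<le> |1 - z| \<le> 1 + r with r = exp (- 2 pi t); since (1 +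
  r) (1 - r) \<le> 1, the lower side gives the larger bound. It serves as boundedness for fixed t
  and as decay for t -> infinity.\<close>

lemma lnk_decay:
  assumes t: "t > 0"
  shows "\<bar>lnk t x\<bar> \<le> - ln (1 - exp (- 2 * pi * t))"
proof -
  let ?r = "exp (- 2 * pi * t)"
  have r: "0 < ?r" "?r < 1" using t by auto
  have "cmod (1 - zp t x) \<le> 1 + ?r" using norm_triangle_ineq4[of 1 "zp t x"] by (simp add: norm_zp)
  then have up: "den t x \<le> (1 + ?r)\<^sup>2" unfolding den_eq by (intro power_mono) auto
  have d: "den t x > 0" by (rule den_pos[OF t])
  have "(1 - ?r)\<^sup>2 > 0" using t by simp
  then have "ln ((1 - ?r)\<^sup>2) \<le> ln (den t x)" using den_ge[of t x] d by simp
  then have 1: "2 * ln (1 - ?r) \<le> ln (den t x)" using r by (simp add: ln_realpow)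
  have "(1 + ?r)\<^sup>2 > 0" using up d by linarith
  then have "ln (den t x) \<le> ln ((1 + ?r)\<^sup>2)" using up d by simp
  then have 2: "ln (den t x) \<le> 2 * ln (1 + ?r)" using r by (simp add: ln_realpow)
  have "(1 + ?r) * (1 - ?r) \<le> 1" by (simp add: algebra_simps)
  then have "ln ((1 + ?r) * (1 - ?r)) \<le> ln 1" using r by (subst ln_le_cancel_iff) (auto intro!: mult_pos_pos add_pos_pos)
  moreover have "ln ((1 + ?r) * (1 - ?r)) = ln (1 + ?r) + ln (1 - ?r)"
    by (rule ln_mult_pos) (use r in linarith)+
  ultimately have "ln (1 + ?r) + ln (1 - ?r) \<le> 0" by simp
  then show ?thesis using 1 2 unfolding lnk_def by linarith
qed

lemma lnk_bounded:
  assumes "t > 0" obtains C where "\<And>x. \<bar>lnk t x\<bar> \<le> C"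
  using lnk_decay[OF assms] by blast

lemma integrable_lnk:
  assumes "prob_space \<rho>" "sets \<rho> = sets borel" and t: "t > 0"
  shows "integrable \<rho> (\<lambda>y. lnk t (z - y))"
proof -
  interpret prob_space \<rho> by fact
  have [measurable_cong]: "sets \<rho> = sets borel" by fact
  have [measurable]: "lnk t \<in> borel_measurable borel" by (rule measurable_lnk[OF t])
  obtain C where "\<And>x. \<bar>lnk t x\<bar> \<le> C" using lnk_bounded[OF t] by blast
  then show ?thesis by (intro integrable_const_bound[where B=C]) (auto intro!: AE_I2)
qed

text \<open>Averaging against the Poisson kernel centred at z turns an almost everywhere bound into
  a bound at every z, now for a bounded kernel. The shift by ln 2 makes all integrands nonnegative,
  so the order of integration can be exchanged freely.\<close>

lemma essinf_bound_smoothed: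
  assumes \<rho>: "torus_prob \<rho>" and c: "AE x in restrict_space lborel {0..<1}. ereal c \<le> Wconv \<rho> x"
    and t: "t > 0"
  shows "c \<le> (\<integral>y. lnk t (z - y) \<partial>\<rho>)"
proof -
  interpret prob_space \<rho> using \<rho> by (simp add: torus_prob_def)
  have sets [measurable_cong]: "sets \<rho> = sets borel" using \<rho> by (simp add: torus_prob_def)
  interpret pair_sigma_finite lborel \<rho> ..
  have [measurable]: "pk t \<in> borel_measurable borel" "lnk t \<in> borel_measurable borel"
    by (rule measurable_pk[OF t], rule measurable_lnk[OF t])
  let ?I = "\<lambda>x. \<integral>\<^sup>+ y. Wshift (x - y) \<partial>\<rho>"
  have int: "integrable \<rho> (\<lambda>y. lnk t (z - y))"
    using \<rho> t by (intro integrable_lnk) (auto simp: torus_prob_def)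
  have AE: "AE x in lborel. x \<in> {0..1} \<longrightarrow> ennreal (c + ln 2) \<le> ?I x"
  proof -
    have "AE x in lborel. x \<in> {0..<1} \<longrightarrow> ereal c \<le> Wconv \<rho> x"
      using c by (subst (asm) AE_restrict_space_iff) auto
    \<comment> \<open>The torus is [0,1) but the Poisson integrals run over [0,1]; the extra
      endpoint is discarded as a null set.\<close>
    moreover have "AE x in lborel. x \<noteq> (1::real)" by (rule AE_lborel_singleton)
    ultimately show ?thesis
    proof eventually_elim
      fix x :: real
      assume 1: "x \<in> {0..<1} \<longrightarrow> ereal c \<le> Wconv \<rho> x" "x \<noteq> 1"
      show "x \<in> {0..1} \<longrightarrow> ennreal (c + ln 2) \<le> ?I x"
      proof
        assume "x \<in> {0..1}"
        then have "ereal c \<le> enn2ereal (?I x) - ereal (ln 2)" using 1 by (auto simp: Wconv_def)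
        then have "ereal (c + ln 2) \<le> enn2ereal (?I x)"
          by (simp add: ereal_le_minus)
        then have "e2ennreal (ereal (c + ln 2)) \<le> e2ennreal (enn2ereal (?I x))"
          by (rule e2ennreal_mono)
        then show "ennreal (c + ln 2) \<le> ?I x" by (simp add: ennreal.abs_eq e2ennreal_ereal)
      qed
    qed
  qed
  have "((\<lambda>x. pk t (x - z)) has_integral 1) {0..1}"
    using integral_pk[OF t, of z] by (metis (no_types, lifting) ext pk_minus minus_diff_eq)
  then have pk1: "(\<integral>\<^sup>+ x. ennreal (pk t (x - z)) * indicator {0..1} x \<partial>lborel) = ennreal 1"
    using pk_pos[OF t] by (intro nn_integral_has_integral_lebesgue') (auto simp: less_imp_le)
  have "ennreal (c + ln 2) = (\<integral>\<^sup>+ x. ennreal (c + ln 2) * (ennreal (pk t (x - z)) * indicator {0..1} x) \<partial>lborel)"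
    by (subst nn_integral_cmult) (auto simp: pk1)
  also have "\<dots> \<le> (\<integral>\<^sup>+ x. ?I x * (ennreal (pk t (x - z)) * indicator {0..1} x) \<partial>lborel)"
  proof (rule nn_integral_mono_AE)
    show "AE x in lborel. ennreal (c + ln 2) * (ennreal (pk t (x - z)) * indicator {0..1} x)
       \<le> ?I x * (ennreal (pk t (x - z)) * indicator {0..1} x)"
      using AE by eventually_elim (auto intro!: mult_right_mono simp: indicator_def)
  qed
  also have "\<dots> = (\<integral>\<^sup>+ x. \<integral>\<^sup>+ y. ennreal (pk t (x - z)) * Wshift (x - y) * indicator {0..1} x \<partial>\<rho> \<partial>lborel)"
    by (intro nn_integral_cong, subst nn_integral_multc[symmetric]) (auto intro!: nn_integral_cong simp: mult_ac)
  also have "\<dots> = (\<integral>\<^sup>+ y. \<integral>\<^sup>+ x. ennreal (pk t (x - z)) * Wshift (x - y) * indicator {0..1} x \<partial>lborel \<partial>\<rho>)"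
    by (rule Fubini'[symmetric]) measurable
  also have "\<dots> \<le> (\<integral>\<^sup>+ y. ennreal (lnk t (z - y) + ln 2) \<partial>\<rho>)"
    by (intro nn_integral_mono Wshift_conv_pk_le t)
  also have "\<dots> = ennreal (\<integral>y. lnk t (z - y) + ln 2 \<partial>\<rho>)"
    using int lnk_ge[OF t] by (intro nn_integral_eq_integral) auto
  finally have "ennreal (c + ln 2) \<le> ennreal (\<integral>y. lnk t (z - y) + ln 2 \<partial>\<rho>)" .
  moreover have "(\<integral>y. lnk t (z - y) + ln 2 \<partial>\<rho>) \<ge> 0"
    using lnk_ge[OF t] by (intro integral_nonneg_AE AE_I2) auto
  ultimately have "c + ln 2 \<le> (\<integral>y. lnk t (z - y) + ln 2 \<partial>\<rho>)"
    by (simp add: ennreal_le_iff)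
  also have "\<dots> = (\<integral>y. lnk t (z - y) \<partial>\<rho>) + ln 2"
    using int by (simp add: prob_space)
  finally show ?thesis by simp
qed

section \<open>Duality between measures and test densities\<close>

lemma integral_density_unit:
  fixes f :: "real \<Rightarrow> real"
  assumes "continuous_on UNIV f"
  shows "(\<integral>x. f x \<partial>density lborel (\<lambda>x. ennreal (indicator {0..1} x))) = integral {0..1} f"
proof -
  have "(\<integral>x. f x \<partial>density lborel (\<lambda>x. ennreal (indicator {0..1} x))) = (LINT x:{0..1}|lborel. f x)"
    unfolding set_lebesgue_integral_def
    using assms by (intro integral_density) (auto intro: borel_measurable_continuous_onI)
  also have "\<dots> = integral {0..1} f"
    using assms by (intro set_borel_integral_eq_integral borel_integrable_atLeastAtMost')
      (auto intro: continuous_on_subset)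
  finally show ?thesis .
qed

text \<open>Integrating the bound on the potential of \<rho> against the probability density h and
  exchanging the integrals moves the kernel onto h, where g dominates.\<close>

lemma fubini_lower_bound:
  fixes k h :: "real \<Rightarrow> real"
  assumes \<rho>: "prob_space \<rho>" "sets \<rho> = sets borel"
    and k: "continuous_on UNIV k" "\<And>x. \<bar>k x\<bar> \<le> C"
    and h: "continuous_on UNIV h" "\<And>x. h x \<ge> 0" "integral {0..1} h = 1"
    and c: "\<And>x. c \<le> (\<integral>y. k (x - y) \<partial>\<rho>)"
    and g: "integrable \<rho> g" "\<And>y. integral {0..1} (\<lambda>x. k (x - y) * h x) \<le> g y"
  shows "c \<le> (\<integral>y. g y \<partial>\<rho>)"
proof -
  interpret R: prob_space \<rho> by fact
  have sets [measurable_cong]: "sets \<rho> = sets borel" by fact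
  define N :: "real measure" where "N = density lborel (\<lambda>x. ennreal (indicator {0..1} x))"
  have [measurable_cong, simp]: "sets N = sets borel" by (simp add: N_def)
  interpret N: finite_measure N
    by standard (simp add: N_def emeasure_density ennreal_indicator)
  interpret P: pair_sigma_finite N \<rho> ..
  \<comment> \<open>Only the values of h on the unit interval matter; freezing it outside makes it bounded.\<close>
  define h' where "h' x = h (max 0 (min 1 x))" for x
  have h'_cont: "continuous_on UNIV h'"
    unfolding h'_def[abs_def] by (intro continuous_on_compose_UNIV[OF h(1)] continuous_intros)
  have h'_eq: "h' x = h x" if "x \<in> {0..1}" for x
    using that by (simp add: h'_def)
  have h'_nonneg: "h' x \<ge> 0" for x by (simp add: h'_def h)
  obtain B where B: "\<And>x. \<bar>h' x\<bar> \<le> B"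
  proof -
    have "compact (h ` {0..1})" by (intro compact_continuous_image continuous_on_subset[OF h(1)]) auto
    then obtain B where "\<forall>y\<in>h ` {0..1}. norm y \<le> B"
      using compact_imp_bounded bounded_iff by metis
    then have "\<bar>h' x\<bar> \<le> B" for x by (auto simp: h'_def)
    then show ?thesis using that by blast
  qed
  have B0: "B \<ge> 0" "C \<ge> 0" using B[of 0] k(2)[of 0] by auto
  have [measurable]: "k \<in> borel_measurable borel" "h' \<in> borel_measurable borel"
    using k(1) h'_cont by (auto intro: borel_measurable_continuous_onI)
  have PF: "finite_measure (N \<Otimes>\<^sub>M \<rho>)"
    by (intro finite_measure_pair_measure) unfold_locales
  have F: "integrable (N \<Otimes>\<^sub>M \<rho>) (\<lambda>(x, y). k (x - y) * h' x)"
  proof (rule finite_measure.integrable_const_bound[OF PF, where B="C * B"])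
    show "AE x in N \<Otimes>\<^sub>M \<rho>. norm (case x of (x, y) \<Rightarrow> k (x - y) * h' x) \<le> C * B"
      using k(2) B B0 by (auto intro!: AE_I2 mult_mono simp: abs_mult)
  qed measurable
  have hc: "integral {0..1} (\<lambda>x. c * h' x) = c"
  proof -
    have "integral {0..1} (\<lambda>x. c * h' x) = c * integral {0..1} h'"
      by (rule Henstock_Kurzweil_Integration.integral_mult_right)
    also have "integral {0..1} h' = integral {0..1} h"
      using h'_eq by (rule integral_cong)
    finally show ?thesis using h by simp
  qed
  have "(\<integral>x. c * h' x \<partial>N) = integral {0..1} (\<lambda>x. c * h' x)"
    unfolding N_def by (intro integral_density_unit continuous_intros h'_cont)
  then have "c = (\<integral>x. c * h' x \<partial>N)" using hc by linarith
  also have "\<dots> \<le> (\<integral>x. (\<integral>y. k (x - y) * h' x \<partial>\<rho>) \<partial>N)"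
  proof (rule integral_mono)
    show "integrable N (\<lambda>x. c * h' x)"
      using B B0 by (intro N.integrable_const_bound[where B="\<bar>c\<bar> * B"])
        (auto intro!: AE_I2 mult_mono simp: abs_mult)
    show "integrable N (\<lambda>x. \<integral>y. k (x - y) * h' x \<partial>\<rho>)"
      using P.integrable_fst'[OF F] by simp
    show "c * h' x \<le> (\<integral>y. k (x - y) * h' x \<partial>\<rho>)" for x
      using mult_right_mono[OF c h'_nonneg, of x x] by simp
  qed
  also have "\<dots> = (\<integral>y. (\<integral>x. k (x - y) * h' x \<partial>N) \<partial>\<rho>)"
    using P.Fubini_integral[OF F] by simp
  also have "\<dots> \<le> (\<integral>y. g y \<partial>\<rho>)"
  proof (rule integral_mono[OF _ g(1)])
    show "integrable \<rho> (\<lambda>y. \<integral>x. k (x - y) * h' x \<partial>N)"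
      using P.integrable_snd[OF F] by simp
    fix y
    have "(\<integral>x. k (x - y) * h' x \<partial>N) = integral {0..1} (\<lambda>x. k (x - y) * h' x)"
      unfolding N_def by (intro integral_density_unit continuous_intros h'_cont continuous_on_compose_UNIV[OF k(1)])
    also have "\<dots> = integral {0..1} (\<lambda>x. k (x - y) * h x)"
      using h'_eq by (intro integral_cong) simp
    finally show "(\<integral>x. k (x - y) * h' x \<partial>N) \<le> g y" using g(2)[of y] by simp
  qed
  finally show ?thesis .
qed

text \<open>The constant test density 1 suffices, because the kernel has mean zero. This gives
  nonnegative energy, which also settles arcs without positive discrepancy.\<close>

lemma essinf_bound_nonpos:
  assumes \<rho>: "torus_prob \<rho>" and c: "AE x in restrict_space lborel {0..<1}. ereal c \<le> Wconv \<rho> x"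
  shows "c \<le> 0"
proof -
  have p: "prob_space \<rho>" "sets \<rho> = sets borel" using \<rho> by (auto simp: torus_prob_def)
  obtain C where C: "\<And>x. \<bar>lnk 1 x\<bar> \<le> C" using lnk_bounded[of 1] by auto
  have "c \<le> (\<integral>y. 0 \<partial>\<rho>)"
  proof (rule fubini_lower_bound[OF p, where k="lnk 1" and h="\<lambda>_. 1" and C=C])
    show "continuous_on UNIV (lnk 1)" by (intro continuous_intros) auto
    show "integral {0..1} (\<lambda>x. lnk 1 (x - y) * 1) \<le> 0" for y
      using integral_unique[OF integral_lnk[of 1 y]] by simp
    show "c \<le> (\<integral>y. lnk 1 (x - y) \<partial>\<rho>)" for x
      by (rule essinf_bound_smoothed[OF \<rho> c]) simp
  qed (use C in auto)
  then show ?thesis by simp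
qed

lemma essinf_bound_discrepancy:
  assumes \<rho>: "torus_prob \<rho>" and c: "AE x in restrict_space lborel {0..<1}. ereal c \<le> Wconv \<rho> x"
    and L: "0 \<le> L" "L < 1" and \<delta>: "measure \<rho> (arc a L) - L > 0"
  shows "c \<le> - (measure \<rho> (arc a L) - L)\<^sup>2 / 2"
proof -
  have p: "prob_space \<rho>" "sets \<rho> = sets borel" using \<rho> by (auto simp: torus_prob_def)
  interpret prob_space \<rho> by fact
  have [measurable_cong]: "sets \<rho> = sets borel" by fact
  define \<delta> where "\<delta> = measure \<rho> (arc a L) - L"
  \<comment> \<open>The ellipse then has height \<delta>, and \<delta> \<le> 1 with pi > 2 gives the
    b \<le> 1/2 that \<open>bump_super\<close> asks for.\<close>
  define b where "b = \<delta> / pi"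
  define A where "A = lifted_arc a L"
  have d: "0 < \<delta>" "\<delta> \<le> 1" using \<delta> prob_le_1[of "arc a L"] L by (auto simp: \<delta>_def simp del: prob_le_1)
  have b: "0 < b" "b \<le> 1/2" "pi * b = \<delta>"
    using d pi_gt3 by (auto simp: b_def field_simps)
  have D_super: "conv_pk (bump b A) t x \<ge> bump b A x - pi * t" if "t > 0" for t x
    unfolding A_def
    by (rule bump_super[OF closed_lifted_arc lifted_arc_nonempty[OF L(1)] lifted_arc_plus_1 b(1,2) that])
  have D_cont: "continuous_on UNIV (bump b A)" by (rule continuous_on_bump)
  have D_le: "bump b A x \<le> \<delta>" "bump b A x \<ge> 0" for x
    using semicirc_antimono[of 0 "infdist x A" b] b by (auto simp: bump_def)
  have D_meas: "bump b A \<in> borel_measurable borel" by (rule borel_measurable_continuous_onI[OF D_cont])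
  then have D_int: "integrable \<rho> (bump b A)"
    using D_le by (intro integrable_const_bound[where B=\<delta>]) (auto intro!: AE_I2 simp: measurable_cong_sets[OF p(2) refl])
  have arc_sets: "arc a L \<in> sets \<rho>"
    unfolding p(2) arc_def frac_def by measurable
  have "\<delta> * measure \<rho> (arc a L) = (\<integral>x. \<delta> * indicator (arc a L) x \<partial>\<rho>)"
    using arc_sets by simp
  also have "\<dots> \<le> (\<integral>x. bump b A x \<partial>\<rho>)"
  proof (rule integral_mono[OF _ D_int])
    show "integrable \<rho> (\<lambda>x. \<delta> * indicator (arc a L) x)"
      using arc_sets by (intro integrable_mult_right integrable_real_indicator) (auto simp: less_top[symmetric])
    show "\<delta> * indicator (arc a L) x \<le> bump b A x" for x
    proof (cases "x \<in> arc a L")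
      case True
      then have "x \<in> A" using arc_subset_lifted_arc by (auto simp: A_def)
      then show ?thesis using b True by (simp add: bump_def)
    qed (use D_le in auto)
  qed
  finally have D_ge: "\<delta> * measure \<rho> (arc a L) \<le> (\<integral>x. bump b A x \<partial>\<rho>)" .
  \<comment> \<open>The same t smooths the kernel and discretises the generator; the two losses pi t
    add up.\<close>
  have main: "c \<le> - \<delta>\<^sup>2 / 2 + 2 * pi * t" if t: "t > 0" for t
  proof -
    obtain C where C: "\<And>x. \<bar>lnk t x\<bar> \<le> C" using lnk_bounded[OF t] by blast
    have "c \<le> (\<integral>y. - (bump b A y - integral {0..1} (bump b A) - pi * (t + t)) \<partial>\<rho>)"
    proof (rule fubini_lower_bound[OF p, where k="lnk t" and h="dual_density (bump b A) t" and C=C])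
      show "continuous_on UNIV (lnk t)" using t by (intro continuous_intros) auto
      show "continuous_on UNIV (dual_density (bump b A) t)" by (rule continuous_on_dual_density[OF D_cont t])
      show "integral {0..1} (dual_density (bump b A) t) = 1" by (rule integral_dual_density[OF D_cont t])
      show "0 \<le> dual_density (bump b A) t x" for x
        using D_super[OF t, of x] t by (simp add: dual_density_def[OF D_cont] field_simps)
      show "c \<le> (\<integral>y. lnk t (x - y) \<partial>\<rho>)" for x
        by (rule essinf_bound_smoothed[OF \<rho> c t])
      show "integral {0..1} (\<lambda>x. lnk t (x - y) * dual_density (bump b A) t x)
         \<le> - (bump b A y - integral {0..1} (bump b A) - pi * (t + t))" for y
        by (rule integral_lnk_dual_density[OF D_cont t t D_super])
    qed (use C D_int in auto)
    also have "\<dots> = - (\<integral>y. bump b A y \<partial>\<rho>) + integral {0..1} (bump b A) + 2 * pi * t"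
      using D_int by (simp add: prob_space)
    also have "\<dots> \<le> - (\<delta> * measure \<rho> (arc a L)) + (L * \<delta> + \<delta>\<^sup>2 / 2) + 2 * pi * t"
      using D_ge integral_bump_le[OF b(1,2) L, of a] by (simp add: b(3) A_def)
    \<comment> \<open>The mass of the arc minus L is \<delta>, so the terms linear in \<delta>
      combine to - \<delta>^2, half of which pays for the two quarter-ellipses.\<close>
    also have "\<dots> = - \<delta>\<^sup>2 / 2 + 2 * pi * t"
      by (simp add: \<delta>_def power2_eq_square field_simps)
    finally show ?thesis .
  qed
  have "c \<le> - \<delta>\<^sup>2 / 2 + e" if "e > 0" for e
    using main[of "e / (2 * pi)"] that by simp
  then show ?thesis unfolding \<delta>_def[symmetric] by (rule field_le_epsilon)
qed

text \<open>The case of infinite energy is kept apart because \<open>real_of_ereal\<close> would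
  return 0 for it. Nonnegativity is recorded as well since \<open>discr_sharp\<close> reuses
  it.\<close>

lemma discr_le:
  assumes \<rho>: "torus_prob \<rho>" and H: "Henergy \<rho> \<noteq> \<infinity>"
  shows "0 \<le> real_of_ereal (Henergy \<rho>) \<and> discr \<rho> \<le> sqrt 2 * sqrt (real_of_ereal (Henergy \<rho>))"
proof -
  let ?S = "{c. AE x in restrict_space lborel {0..<1}. c \<le> Wconv \<rho> x}"
  have upper: "ereal u \<le> Henergy \<rho>"
    if u: "\<And>c. (AE x in restrict_space lborel {0..<1}. ereal c \<le> Wconv \<rho> x) \<Longrightarrow> c \<le> - u" for u
  proof -
    have "Sup ?S \<le> ereal (- u)"
    proof (rule Sup_least)
      fix c assume c: "c \<in> ?S"
      show "c \<le> ereal (- u)"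
      proof (cases c)
        case (real r) then show ?thesis using u[of r] c by simp
      next
        \<comment> \<open>The assumption \<open>u\<close> speaks of real bounds only. An infinite c
          yields the real bound 1 - u, which it refutes.\<close>
        case PInf
        then have "AE x in restrict_space lborel {0..<1}. ereal (1 - u) \<le> Wconv \<rho> x"
          using c by (auto elim!: eventually_mono)
        then show ?thesis using u[of "1 - u"] by simp
      qed simp
    qed
    then have "- ereal (- u) \<le> - Sup ?S" by (simp only: ereal_minus_le_minus)
    then show ?thesis by (simp add: Henergy_def essinf_def)
  qed
  have "ereal 0 \<le> Henergy \<rho>" by (rule upper) (use essinf_bound_nonpos[OF \<rho>] in simp)
  then obtain h where h: "Henergy \<rho> = ereal h" "h \<ge> 0"
    using H by (cases "Henergy \<rho>") auto
  have "measure \<rho> (arc a L) - L \<le> sqrt (2 * h)" if L: "0 \<le> L" "L < 1" for a L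
  proof (cases "measure \<rho> (arc a L) - L > 0")
    case True
    have "ereal ((measure \<rho> (arc a L) - L)\<^sup>2 / 2) \<le> Henergy \<rho>"
      by (rule upper) (use essinf_bound_discrepancy[OF \<rho> _ L True] in simp)
    then show ?thesis using h by (intro real_le_rsqrt) simp
  next
    case False
    then show ?thesis using h by (smt (verit) real_sqrt_ge_zero mult_nonneg_nonneg)
  qed
  then have "discr \<rho> \<le> sqrt (2 * h)"
    unfolding discr_def by (intro cSUP_least) auto
  then show ?thesis using h by (simp add: real_sqrt_mult)
qed

section \<open>The complex potential of the extremal measure\<close>

definition casinh :: "complex \<Rightarrow> complex" where
  "casinh Y = Ln (Y + csqrt (Y\<^sup>2 + 1))"

lemma nonzero_if_Re_pos: "Re z > 0 \<Longrightarrow> z \<noteq> 0"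
  by auto

lemma Re_of_real_mult: "Re (of_real r * z) = r * Re z"
  by simp

context
  fixes Y :: complex
  assumes Y: "Re Y > 0"
begin

lemma casinh_sqrt_arg: "Y\<^sup>2 + 1 \<notin> \<real>\<^sub>\<le>\<^sub>0"
proof
  assume "Y\<^sup>2 + 1 \<in> \<real>\<^sub>\<le>\<^sub>0"
  then have "Im (Y\<^sup>2) = 0" "Re (Y\<^sup>2) \<le> - 1" by (auto simp: complex_nonpos_Reals_iff)
  then have "Re Y * Im Y = 0" "(Re Y)\<^sup>2 - (Im Y)\<^sup>2 \<le> - 1" by (auto simp: power2_eq_square)
  then show False using Y by (auto simp: power2_eq_square) (smt (verit) mult_pos_pos)
qed

lemma casinh_Re_sqrt: "Re (csqrt (Y\<^sup>2 + 1)) > 0"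
proof -
  have "Re (csqrt (Y\<^sup>2 + 1)) \<noteq> 0"
  proof
    assume "Re (csqrt (Y\<^sup>2 + 1)) = 0"
    then have "(csqrt (Y\<^sup>2 + 1))\<^sup>2 \<in> \<real>\<^sub>\<le>\<^sub>0"
      by (auto simp: complex_nonpos_Reals_iff power2_eq_square)
    then show False using casinh_sqrt_arg by simp
  qed
  moreover have "Re (csqrt (Y\<^sup>2 + 1)) \<ge> 0" using csqrt_principal by (metis less_eq_real_def)
  ultimately show ?thesis by simp
qed

lemma casinh_arg_pos: "Re (Y + csqrt (Y\<^sup>2 + 1)) > 0"
  unfolding plus_complex.sel by (intro add_pos_pos Y casinh_Re_sqrt)

lemma casinh_prod: "(csqrt (Y\<^sup>2 + 1) + Y) * (csqrt (Y\<^sup>2 + 1) - Y) = 1"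
proof -
  have "(csqrt (Y\<^sup>2 + 1) + Y) * (csqrt (Y\<^sup>2 + 1) - Y) = (csqrt (Y\<^sup>2 + 1))\<^sup>2 - Y\<^sup>2"
    by (simp add: power2_eq_square algebra_simps)
  then show ?thesis by simp
qed

lemma exp_casinh: "exp (casinh Y) = csqrt (Y\<^sup>2 + 1) + Y"
proof -
  have "Y + csqrt (Y\<^sup>2 + 1) \<noteq> 0" by (rule nonzero_if_Re_pos[OF casinh_arg_pos])
  then show ?thesis unfolding casinh_def by (simp add: add.commute)
qed

lemma exp_minus_casinh: "exp (- casinh Y) = csqrt (Y\<^sup>2 + 1) - Y"
  unfolding exp_minus exp_casinh using casinh_prod by (rule inverse_unique)

lemma cosh_casinh: "cosh (casinh Y) = csqrt (Y\<^sup>2 + 1)"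
  by (simp add: cosh_field_def exp_casinh exp_minus_casinh)

lemma Im_casinh: "\<bar>Im (casinh Y)\<bar> < pi / 2"
  unfolding casinh_def Re_Ln_pos_lt[OF nonzero_if_Re_pos[OF casinh_arg_pos]] by (rule casinh_arg_pos)

text \<open>With c the square root, exp A and exp (- A) are c + Y and c - Y, of product 1, so it is
  enough that |c - Y| \<le> |c + Y|. The imaginary part of c^2 = Y^2 + 1 shows that Im c and Im Y do
  not have opposite signs, and the real parts are positive.\<close>

lemma Re_casinh: "Re (casinh Y) \<ge> 0"
proof -
  define c where "c = csqrt (Y\<^sup>2 + 1)"
  have csq: "c\<^sup>2 = Y\<^sup>2 + 1" by (simp add: c_def)
  have cpos: "Re c > 0" unfolding c_def by (rule casinh_Re_sqrt)
  have im: "Re c * Im c = Re Y * Im Y"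
    using arg_cong[OF csq, of Im] by (simp add: power2_eq_square mult.commute)
  have "Re c * (Im c * Im Y) = Re Y * (Im Y)\<^sup>2"
    using im by (simp add: power2_eq_square flip: mult.assoc)
  then have "Re c * (Im c * Im Y) \<ge> 0" using Y by simp
  then have "Im c * Im Y \<ge> 0" using cpos by (simp add: zero_le_mult_iff)
  moreover have "Re c * Re Y \<ge> 0" using cpos Y by simp
  moreover have "(cmod (c + Y))\<^sup>2 - (cmod (c - Y))\<^sup>2 = 4 * (Re c * Re Y + Im c * Im Y)"
    unfolding cmod_power2 by (simp add: power2_eq_square algebra_simps)
  ultimately have "(cmod (c + Y))\<^sup>2 - (cmod (c - Y))\<^sup>2 \<ge> 0" by simp
  then have "(cmod (c - Y))\<^sup>2 \<le> (cmod (c + Y))\<^sup>2" by (simp only: diff_ge_0_iff_ge)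
  then have le: "cmod (c - Y) \<le> cmod (c + Y)" by (rule power2_le_imp_le) simp
  have prod: "cmod (c + Y) * cmod (c - Y) = 1"
    using casinh_prod unfolding c_def by (metis norm_mult norm_one)
  have "1 \<le> cmod (c + Y)"
  proof (rule ccontr)
    assume "\<not> 1 \<le> cmod (c + Y)"
    then have "cmod (c + Y) * cmod (c - Y) < 1 * 1"
      using le by (intro mult_strict_mono') auto
    then show False using prod by simp
  qed
  then have "1 \<le> exp (Re (casinh Y))"
    unfolding norm_exp_eq_Re[symmetric] exp_casinh c_def .
  then show ?thesis by simp
qed

lemma casinh_has_derivative: "(casinh has_field_derivative 1 / csqrt (Y\<^sup>2 + 1)) (at Y)"
proof -
  have nz: "csqrt (Y\<^sup>2 + 1) \<noteq> 0" "Y + csqrt (Y\<^sup>2 + 1) \<noteq> 0"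
    by (rule nonzero_if_Re_pos[OF casinh_Re_sqrt], rule nonzero_if_Re_pos[OF casinh_arg_pos])
  have arg: "Y + csqrt (Y\<^sup>2 + 1) \<notin> \<real>\<^sub>\<le>\<^sub>0"
    using casinh_arg_pos unfolding complex_nonpos_Reals_iff by linarith
  have "((\<lambda>Y. Y\<^sup>2 + 1) has_field_derivative 2 * Y) (at Y)"
    by (auto intro!: derivative_eq_intros)
  then have "((\<lambda>Y. csqrt (Y\<^sup>2 + 1)) has_field_derivative 2 * Y / (2 * csqrt (Y\<^sup>2 + 1))) (at Y)"
    using casinh_sqrt_arg by (rule has_field_derivative_csqrt')
  then have "((\<lambda>Y. Y + csqrt (Y\<^sup>2 + 1)) has_field_derivative 1 + 2 * Y / (2 * csqrt (Y\<^sup>2 + 1))) (at Y)"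
    by (intro DERIV_add DERIV_ident)
  from DERIV_chain2[OF has_field_derivative_Ln[OF arg] this]
  have "(casinh has_field_derivative inverse (Y + csqrt (Y\<^sup>2 + 1)) * (1 + 2 * Y / (2 * csqrt (Y\<^sup>2 + 1)))) (at Y)"
    unfolding casinh_def[abs_def] .
  moreover have "inverse (Y + c) * (1 + 2 * Y / (2 * c)) = 1 / c" if "c \<noteq> 0" "Y + c \<noteq> 0" for c :: complex
    using that by (simp add: field_simps)
  note this[OF nz]
  ultimately show ?thesis by simp
qed

end

lemma Re_cosh_complex: "Re (cosh A) = cosh (Re A) * cos (Im A)"
  by (simp add: cosh_field_def Re_exp algebra_simps add_divide_distrib)

lemma Re_div_1_plus:
  fixes w :: complex
  assumes "Re w \<ge> 0" shows "Re (w / (1 + w)) \<ge> 0"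
proof -
  have "Re (w / (1 + w)) = (Re w * (1 + Re w) + Im w * Im w) / ((1 + Re w)\<^sup>2 + (Im w)\<^sup>2)"
    by (simp add: Re_divide)
  also have "\<dots> \<ge> 0" using assms by (intro divide_nonneg_nonneg add_nonneg_nonneg) auto
  finally show ?thesis .
qed

section \<open>The A-derivative of the potential and its primitive on a strip\<close>

locale extremal_param =
  fixes q m :: real
  assumes q: "0 < q" "q < 1" and m: "0 < m" and mq: "m\<^sup>2 + q\<^sup>2 = 1"
begin

definition strip :: "complex set" where "strip = {A. \<bar>Im A\<bar> < pi / 2}"

text \<open>With w = q cosh A, the value m w / (1 + w) is forced by three relations: z \<Phi>' = (w
  - 1) / 2, w^2 - 1 = 4 m^2 z / (1 - z)^2 and dA/dz = 2 m / (w (1 - z)^2).\<close>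

definition F :: "complex \<Rightarrow> complex" where
  "F A = of_real m * (of_real q * cosh A / (1 + of_real q * cosh A))"

text \<open>The value of A at z = 0, where w = 1.\<close>

definition \<alpha> :: real where "\<alpha> = arsinh (m / q)"

lemma m_less_1: "m < 1"
proof -
  have "m\<^sup>2 < 1\<^sup>2" using mq q by (smt (verit) one_power2 zero_less_power)
  then show ?thesis by (rule power2_less_imp_less) simp
qed

lemma Re_w_pos: "A \<in> strip \<Longrightarrow> Re (of_real q * cosh A) > 0"
  unfolding strip_def using q cosh_real_pos[of "Re A"]
  by (auto simp: Re_cosh_complex intro!: mult_pos_pos cos_gt_zero_pi)

lemma open_strip: "open strip"
proof -
  have eq: "strip = {A. - (pi / 2) < Im A} \<inter> {A. Im A < pi / 2}" by (auto simp: strip_def)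
  show ?thesis unfolding eq by (intro open_Int open_halfspace_Im_gt open_halfspace_Im_lt)
qed

lemma convex_strip: "convex strip"
proof -
  have eq: "strip = {A. - (pi / 2) < Im A} \<inter> {A. Im A < pi / 2}" by (auto simp: strip_def)
  show ?thesis unfolding eq by (intro convex_Int convex_halfspace_Im_gt convex_halfspace_Im_lt)
qed

lemma F_holomorphic: "F holomorphic_on strip"
proof -
  have "1 + of_real q * cosh A \<noteq> 0" if "A \<in> strip" for A
    using Re_w_pos[OF that] by (auto simp: complex_eq_iff)
  then show ?thesis unfolding F_def[abs_def] cosh_field_def by (intro holomorphic_intros) auto
qed

text \<open>Convexity of the strip provides a primitive by existence only, hence the choice.
  Vanishing at \<alpha> makes the potential zero at the centre of the disc, that is, zero in the
  limit t -> infinity.\<close>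

definition \<psi> :: "complex \<Rightarrow> complex" where
  "\<psi> = (SOME g. (\<forall>A\<in>strip. (g has_field_derivative F A) (at A)) \<and> g (of_real \<alpha>) = 0)"

lemma \<psi>: "\<forall>A\<in>strip. (\<psi> has_field_derivative F A) (at A)" "\<psi> (of_real \<alpha>) = 0"
proof -
  obtain g where g: "\<And>A. A \<in> strip \<Longrightarrow> (g has_field_derivative F A) (at A within strip)"
    using holomorphic_convex_primitive'[OF convex_strip open_strip F_holomorphic] by blast
  have "((\<lambda>A. g A - g (of_real \<alpha>)) has_field_derivative F A) (at A)" if "A \<in> strip" for A
    using g[OF that] at_within_open[OF that open_strip] by (auto intro!: derivative_eq_intros)
  then have "\<exists>g. (\<forall>A\<in>strip. (g has_field_derivative F A) (at A)) \<and> g (of_real \<alpha>) = 0"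
    by (intro exI[of _ "\<lambda>A. g A - g (of_real \<alpha>)"]) auto
  from someI_ex[OF this] show "\<forall>A\<in>strip. (\<psi> has_field_derivative F A) (at A)" "\<psi> (of_real \<alpha>) = 0"
    unfolding \<psi>_def by auto
qed

lemma Re_\<psi>_derivative:
  assumes "A0 + of_real s * d \<in> strip"
  shows "((\<lambda>s. Re (\<psi> (A0 + of_real s * d))) has_real_derivative Re (F (A0 + of_real s * d) * d)) (at s)"
proof -
  have "((\<lambda>s. A0 + of_real s * d) has_vector_derivative d) (at s)"
    by (auto intro!: derivative_eq_intros)
  moreover have "(\<psi> has_field_derivative F (A0 + of_real s * d)) (at (A0 + of_real s * d))"
    using \<psi>(1) assms by blast
  ultimately have "((\<psi> \<circ> (\<lambda>s. A0 + of_real s * d)) has_vector_derivative d * F (A0 + of_real s * d)) (at s)"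
    by (rule field_vector_diff_chain_at)
  from bounded_linear.has_vector_derivative[OF bounded_linear_Re this]
  have "((\<lambda>s. Re (\<psi> (A0 + of_real s * d))) has_vector_derivative Re (d * F (A0 + of_real s * d))) (at s)"
    by (simp only: o_def)
  then show ?thesis
    by (simp only: has_real_derivative_iff_has_vector_derivative mult.commute[of d])
qed

lemma sinh_\<alpha>: "sinh \<alpha> = m / q" "cosh \<alpha> = 1 / q" "\<alpha> \<ge> 0"
proof -
  show 1: "sinh \<alpha> = m / q" unfolding \<alpha>_def by (rule sinh_arsinh_real)
  have "(cosh \<alpha>)\<^sup>2 = 1 + (m / q)\<^sup>2" using cosh_square_eq[of \<alpha>] 1 by simp
  also have "\<dots> = (1 / q)\<^sup>2" using q mq by (simp add: field_simps)
  finally show "cosh \<alpha> = 1 / q" using q cosh_real_nonneg[of \<alpha>] by (simp add: power2_eq_iff_nonneg)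
  show "\<alpha> \<ge> 0" using 1 m q sinh_real_nonneg_iff[of \<alpha>] by simp
qed

text \<open>Horizontally the real part of the primitive increases away from the imaginary axis, because
  F takes values in the right half-plane; on the imaginary axis F is real, so there the real part
  is constant.\<close>

lemma Re_\<psi>_ge:
  assumes A: "A \<in> strip" "Re A \<ge> 0"
  shows "Re (\<psi> A) \<ge> - m\<^sup>2 / (2 * q)"
proof -
  define \<beta> where "\<beta> = Im A"
  have \<beta>: "\<bar>\<beta>\<bar> < pi / 2" using A by (simp add: \<beta>_def strip_def)
  have 1: "Re (\<psi> (\<i> * of_real \<beta> + of_real 0 * 1)) \<le> Re (\<psi> (\<i> * of_real \<beta> + of_real (Re A) * 1))"
  proof (rule DERIV_nonneg_imp_nondecreasing[OF A(2)])
    fix s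
    have "\<i> * of_real \<beta> + of_real s * 1 \<in> strip" using \<beta> by (simp add: strip_def)
    moreover from Re_w_pos[OF this]
    have "Re (F (\<i> * of_real \<beta> + of_real s * 1) * 1) \<ge> 0"
      unfolding F_def mult_1_right Re_of_real_mult[of m] using m
      by (intro mult_nonneg_nonneg Re_div_1_plus) auto
    ultimately show "\<exists>y. ((\<lambda>s. Re (\<psi> (\<i> * of_real \<beta> + of_real s * 1))) has_real_derivative y) (at s) \<and> 0 \<le> y"
      using Re_\<psi>_derivative by blast
  qed
  have 2: "Re (\<psi> (0 + of_real 0 * \<i>)) = Re (\<psi> (0 + of_real \<beta> * \<i>))"
  proof (rule DERIV_isconst3[where a="- (pi / 2)" and b="pi / 2"
        and f="\<lambda>s. Re (\<psi> (0 + of_real s * \<i>))"])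
    fix s :: real assume "s \<in> {- (pi / 2)<..<pi / 2}"
    then have "0 + of_real s * \<i> \<in> strip" by (auto simp: strip_def)
    from Re_\<psi>_derivative[OF this]
    have "((\<lambda>s. Re (\<psi> (0 + of_real s * \<i>))) has_real_derivative Re (F (0 + of_real s * \<i>) * \<i>)) (at s)" .
    moreover have "cosh (0 + of_real s * \<i>) = of_real (cos s)"
      by (simp add: cosh_field_def complex_eq_iff Re_exp Im_exp)
    then have "F (0 + of_real s * \<i>) = of_real (m * (q * cos s / (1 + q * cos s)))"
      unfolding F_def by simp
    then have "Re (F (0 + of_real s * \<i>) * \<i>) = 0" by (simp only: Re_complex_of_real Im_complex_of_real times_complex.sel imaginary_unit.sel)
    ultimately show "((\<lambda>s. Re (\<psi> (0 + of_real s * \<i>))) has_real_derivative 0) (at s)" by simp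
  qed (use \<beta> in auto)
  \<comment> \<open>On [0, \<alpha>] one has w = q cosh s \<le> 1, so F is at most m / 2. Hence the
    real part at 0 is at least - m \<alpha> / 2, and \<alpha> \<le> sinh \<alpha> = m / q finishes
    the bound.\<close>
  have 3: "m / 2 * 0 - Re (\<psi> (0 + of_real 0 * 1)) \<le> m / 2 * \<alpha> - Re (\<psi> (0 + of_real \<alpha> * 1))"
  proof (rule DERIV_nonneg_imp_nondecreasing[OF sinh_\<alpha>(3)])
    fix s assume s: "0 \<le> s" "s \<le> \<alpha>"
    have st: "0 + of_real s * 1 \<in> strip" by (simp add: strip_def)
    have c: "cosh (complex_of_real s) = of_real (cosh s)"
      by (simp add: cosh_field_def exp_of_real flip: of_real_minus)
    have "F (0 + of_real s * 1) = of_real (m * (q * cosh s / (1 + q * cosh s)))"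
      unfolding F_def by (simp add: c)
    then have Fs: "Re (F (0 + of_real s * 1) * 1) = m * (q * cosh s / (1 + q * cosh s))"
      by (simp only: mult_1_right Re_complex_of_real)
    have "cosh s \<le> cosh \<alpha>" using s by (intro cosh_real_nonneg_le_iff[THEN iffD2]) auto
    then have "q * cosh s \<le> 1" using sinh_\<alpha>(2) q by (simp add: field_simps)
    moreover have "q * cosh s > 0" using q cosh_real_pos[of s] by simp
    ultimately have "q * cosh s / (1 + q * cosh s) \<le> 1 / 2" by (simp add: field_simps)
    then have "m * (q * cosh s / (1 + q * cosh s)) \<le> m * (1 / 2)" using m by (intro mult_left_mono) auto
    then have "0 \<le> m / 2 - m * (q * cosh s / (1 + q * cosh s))" by simp
    moreover have "((\<lambda>s. m / 2 * s - Re (\<psi> (0 + of_real s * 1))) has_real_derivative m / 2 - m * (q * cosh s / (1 + q * cosh s))) (at s)"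
      using DERIV_diff[OF DERIV_cmult_Id Re_\<psi>_derivative[OF st], of "m / 2"] unfolding Fs .
    ultimately show "\<exists>y. ((\<lambda>s. m / 2 * s - Re (\<psi> (0 + of_real s * 1))) has_real_derivative y) (at s) \<and> 0 \<le> y"
      by blast
  qed
  have "\<alpha> \<le> sinh \<alpha>" using sinh_\<alpha>(3) by (rule le_sinh)
  then have "m / 2 * \<alpha> \<le> m / 2 * (m / q)" using m sinh_\<alpha>(1) by (intro mult_left_mono) auto
  moreover have "\<i> * of_real \<beta> + of_real (Re A) * 1 = A" by (simp add: complex_eq_iff \<beta>_def)
  ultimately show ?thesis using 1 2 3 \<psi>(2) by (simp add: power2_eq_square mult.commute)
qed

section \<open>Pullback to the unit disc\<close>

definition Yf :: "complex \<Rightarrow> complex" where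
  "Yf z = of_real (m / q) * ((1 + z) / (1 - z))"

text \<open>As q exp (- A) = q cosh A - q sinh A, this is w minus the transform m (1 + z) / (1 - z)
  of the atom, hence the Herglotz transform of the remaining mass. The exponential form makes
  positivity of the real part visible from |Im A| < pi / 2.\<close>

definition gf :: "complex \<Rightarrow> complex" where
  "gf z = of_real q * exp (- casinh (Yf z))"

definition \<Phi> :: "complex \<Rightarrow> complex" where
  "\<Phi> z = \<psi> (casinh (Yf z))"

lemma Re_Yf:
  assumes "cmod z < 1" shows "Re (Yf z) > 0"
proof -
  have nz: "(1 - Re z)\<^sup>2 + (Im z)\<^sup>2 > 0"
    using assms complex_Re_le_cmod[of z] by (intro add_pos_nonneg) auto
  have "(Re z)\<^sup>2 + (Im z)\<^sup>2 < 1" using assms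
    by (metis cmod_power2 norm_ge_zero one_power2 power_strict_mono zero_less_numeral)
  then have "0 < (1 + Re z) * (1 - Re z) - Im z * Im z" by (simp add: power2_eq_square algebra_simps)
  then have "Re ((1 + z) / (1 - z)) > 0" using nz by (simp add: Re_divide)
  then show ?thesis unfolding Yf_def Re_of_real_mult using m q by simp
qed

lemma casinh_Yf_strip: "cmod z < 1 \<Longrightarrow> casinh (Yf z) \<in> strip"
  using Im_casinh[OF Re_Yf] by (simp add: strip_def)

lemma Re_gf_pos: "cmod z < 1 \<Longrightarrow> Re (gf z) > 0"
  using casinh_Yf_strip[of z] q by (auto simp: gf_def Re_exp strip_def intro!: mult_pos_pos cos_gt_zero_pi)

lemma Yf_has_derivative:
  assumes "cmod z < 1"
  shows "(Yf has_field_derivative of_real (m / q) * (2 / (1 - z)\<^sup>2)) (at z)"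
proof -
  have "1 - z \<noteq> 0" using assms by auto
  then have "((\<lambda>z. (1 + z) / (1 - z)) has_field_derivative 2 / (1 - z)\<^sup>2) (at z)"
    by (auto intro!: derivative_eq_intros simp: field_simps power2_eq_square)
  then show ?thesis unfolding Yf_def[abs_def] by (rule DERIV_cmult)
qed

lemma casinh_Yf_has_derivative:
  assumes z: "cmod z < 1"
  shows "((\<lambda>z. casinh (Yf z)) has_field_derivative
     1 / csqrt ((Yf z)\<^sup>2 + 1) * (of_real (m / q) * (2 / (1 - z)\<^sup>2))) (at z)"
  using DERIV_chain2[OF casinh_has_derivative[OF Re_Yf[OF z]] Yf_has_derivative[OF z]] .

lemma gf_holomorphic: "gf holomorphic_on ball 0 1"
proof -
  have "(\<lambda>z. casinh (Yf z)) holomorphic_on ball 0 1"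
    using casinh_Yf_has_derivative by (intro holomorphic_onI) (auto simp: field_differentiable_def intro: DERIV_subset)
  then show ?thesis unfolding gf_def[abs_def] by (intro holomorphic_intros)
qed

text \<open>The equation reads z \<Phi>' = (w - 1) / 2. If w = 1 + 2 sum c_k z^k, it integrates to
  sum c_k z^k / k, the complex potential; a unit atom at 0 gives - log (1 - z).\<close>

lemma \<Phi>_has_derivative:
  assumes z: "cmod z < 1"
  obtains D where "(\<Phi> has_field_derivative D) (at z)"
    "z * D = (gf z + of_real m * ((1 + z) / (1 - z)) - 1) / 2"
proof -
  let ?c = "csqrt ((Yf z)\<^sup>2 + 1)"
  let ?w = "of_real q * ?c"
  let ?D = "F (casinh (Yf z)) * (1 / ?c * (of_real (m / q) * (2 / (1 - z)\<^sup>2)))"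
  have "(\<psi> has_field_derivative F (casinh (Yf z))) (at (casinh (Yf z)))"
    using \<psi>(1) casinh_Yf_strip[OF z] by blast
  from DERIV_chain2[OF this casinh_Yf_has_derivative[OF z]]
  have D: "(\<Phi> has_field_derivative ?D) (at z)" by (simp add: \<Phi>_def[abs_def])
  have nz: "1 - z \<noteq> 0" using z by auto
  have cpos: "Re ?c > 0" by (rule casinh_Re_sqrt[OF Re_Yf[OF z]])
  then have c0: "?c \<noteq> 0" by (rule nonzero_if_Re_pos)
  have "Re ?w > 0" unfolding Re_of_real_mult using cpos q by (intro mult_pos_pos)
  then have "Re (1 + ?w) > 0" unfolding plus_complex.sel one_complex.sel by linarith
  then have w1: "1 + ?w \<noteq> 0" by (rule nonzero_if_Re_pos)
  have q0: "complex_of_real q \<noteq> 0" using q by simp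
  have gw: "gf z + of_real m * ((1 + z) / (1 - z)) = ?w"
  proof -
    have "of_real q * Yf z = of_real m * ((1 + z) / (1 - z))" using q0 by (simp add: Yf_def)
    then show ?thesis unfolding gf_def exp_minus_casinh[OF Re_Yf[OF z]] by (simp add: right_diff_distrib)
  qed
  \<comment> \<open>The condition q^2 + m^2 = 1 removes the constant term here, and the factor w + 1
    of the left side cancels the denominator of F.\<close>
  have wsq: "?w\<^sup>2 - 1 = 4 * of_real (m\<^sup>2) * z / (1 - z)\<^sup>2"
  proof -
    have "?w\<^sup>2 = of_real (q\<^sup>2) * ((Yf z)\<^sup>2 + 1)" by (simp add: power_mult_distrib)
    also have "\<dots> = (of_real q * Yf z)\<^sup>2 + of_real (q\<^sup>2)" by (simp add: power_mult_distrib distrib_left)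
    also have "of_real q * Yf z = of_real m * ((1 + z) / (1 - z))" using q0 by (simp add: Yf_def)
    also have "of_real (q\<^sup>2) = 1 - complex_of_real (m\<^sup>2)" using mq by (metis add_diff_cancel_left' of_real_1 of_real_diff)
    finally have w2: "?w\<^sup>2 = (of_real m * ((1 + z) / (1 - z)))\<^sup>2 + (1 - complex_of_real (m\<^sup>2))" .
    have "(of_real m * X)\<^sup>2 + (1 - complex_of_real (m\<^sup>2)) - 1 = of_real (m\<^sup>2) * (X\<^sup>2 - 1)" for X
      by (simp add: power_mult_distrib algebra_simps)
    then have "?w\<^sup>2 - 1 = of_real (m\<^sup>2) * (((1 + z) / (1 - z))\<^sup>2 - 1)"
      unfolding w2 .
    also have "((1 + z) / (1 - z))\<^sup>2 - 1 = 4 * z / (1 - z)\<^sup>2"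
    proof -
      have "(1 + z)\<^sup>2 = (1 - z)\<^sup>2 + 4 * z" by (simp add: power2_eq_square algebra_simps)
      then show ?thesis unfolding power_divide using nz by (simp add: add_divide_distrib)
    qed
    finally show ?thesis by simp
  qed
  have "z * ?D = (4 * of_real (m\<^sup>2) * z / (1 - z)\<^sup>2) / (2 * (1 + ?w))"
  proof -
    have "z * (M * (Q * c / W) * (1 / c * (M / Q * (2 / P)))) = (4 * M\<^sup>2 * z / P) / (2 * W)"
      if "c \<noteq> 0" "Q \<noteq> 0" "W \<noteq> 0" "P \<noteq> 0" for c Q W P M :: complex
      using that by (simp add: field_simps power2_eq_square)
    from this[OF c0 q0 w1, of "(1 - z)\<^sup>2" "of_real m"] nz show ?thesis
      unfolding F_def cosh_casinh[OF Re_Yf[OF z]] by (simp only: of_real_divide of_real_power) simp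
  qed
  also have "\<dots> = (?w - 1) / 2"
  proof -
    have "?w\<^sup>2 - 1 = (?w - 1) * (1 + ?w)" by (simp add: power2_eq_square algebra_simps)
    moreover have "a * b / (2 * b) = a / 2" if "b \<noteq> 0" for a b :: complex
      using that by simp
    ultimately show ?thesis unfolding wsq[symmetric] using w1 by (simp only:)
  qed
  finally show ?thesis using D gw by (intro that) auto
qed

lemma at_0: "casinh (Yf 0) = of_real \<alpha>" "gf 0 = of_real (1 - m)" "\<Phi> 0 = 0"
proof -
  have Y0: "Re (Yf 0) > 0" by (rule Re_Yf) simp
  have Y: "Yf 0 = of_real (sinh \<alpha>)" by (simp add: Yf_def sinh_\<alpha>)
  have s: "csqrt ((Yf 0)\<^sup>2 + 1) = of_real (cosh \<alpha>)"
  proof -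
    have "(Yf 0)\<^sup>2 + 1 = of_real ((cosh \<alpha>)\<^sup>2)" unfolding Y cosh_square_eq by simp
    then show ?thesis by (simp add: csqrt_of_real_nonneg real_sqrt_abs cosh_real_pos abs_of_pos del: of_real_power)
  qed
  have "Yf 0 + csqrt ((Yf 0)\<^sup>2 + 1) = of_real (exp \<alpha>)"
    unfolding s unfolding Y of_real_add[symmetric] sinh_plus_cosh ..
  then show 1: "casinh (Yf 0) = of_real \<alpha>"
    unfolding casinh_def by (simp add: Ln_of_real)
  have "gf 0 = of_real q * (of_real (cosh \<alpha>) - of_real (sinh \<alpha>))"
    unfolding gf_def exp_minus_casinh[OF Y0] s unfolding Y ..
  also have "\<dots> = of_real (1 - m)" unfolding sinh_\<alpha> using q by (simp add: field_simps)
  finally show "gf 0 = of_real (1 - m)" .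
  show "\<Phi> 0 = 0" unfolding \<Phi>_def 1 by (rule \<psi>(2))
qed

lemma Re_\<Phi>_ge: "cmod z < 1 \<Longrightarrow> Re (\<Phi> z) \<ge> - m\<^sup>2 / (2 * q)"
  unfolding \<Phi>_def by (intro Re_\<psi>_ge casinh_Yf_strip Re_casinh Re_Yf)

end

section \<open>Sharpness\<close>

lemma lnk_decay_tendsto: "((\<lambda>t. - ln (1 - exp (- 2 * pi * t))) \<longlongrightarrow> 0) at_top"
proof -
  have "((\<lambda>t. exp (- 2 * pi * t)) \<longlongrightarrow> 0) at_top"
    by (rule filterlim_compose[OF exp_at_bot filterlim_tendsto_neg_mult_at_bot[OF tendsto_const _ filterlim_ident]]) simp
  then have "((\<lambda>t. - ln (1 - exp (- 2 * pi * t))) \<longlongrightarrow> - ln (1 - 0)) at_top"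
    by (intro tendsto_intros) auto
  then show ?thesis by simp
qed

text \<open>Positivity of the Poisson kernel bounds the t-derivative of \<open>lnk\<close> by pi, so
  \<open>lnk t x - pi * t\<close> decreases in t.\<close>

lemma lnk_shift_ge:
  assumes t: "t > 0" and s: "s > 0"
  shows "lnk t x - lnk (t + s) x \<ge> - pi * s"
proof -
  have "lnk (t + s) x - pi * (t + s) \<le> lnk t x - pi * t"
  proof (rule DERIV_nonpos_imp_nonincreasing[where f="\<lambda>t. lnk t x - pi * t"])
    show "t \<le> t + s" using s by simp
    fix u assume "t \<le> u"
    then have u: "u > 0" using t by simp
    have "((\<lambda>t. lnk t x - pi * t) has_real_derivative - pi * (pk u x - 1) - pi) (at u)"
      by (intro DERIV_diff lnk_has_derivative[OF u] DERIV_cmult_Id)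
    moreover have "- pi * (pk u x - 1) - pi \<le> 0" using pk_pos[OF u, of x] by (simp add: algebra_simps)
    ultimately show "\<exists>y. ((\<lambda>t. lnk t x - pi * t) has_real_derivative y) (at u) \<and> y \<le> 0" by blast
  qed
  then show ?thesis by (simp add: algebra_simps)
qed

lemma zp_has_vector_derivative:
  "((\<lambda>t. zp (t + s) x) has_vector_derivative of_real (- 2 * pi) * zp (t + s) x) (at t)"
proof -
  have "zp (t + s) x = exp (of_real (- 2 * pi) * of_real t) * zp s x" for t
    using zp_mult[of t 0 s x] by (simp add: zp_def Complex_eq)
  moreover have "((\<lambda>t. exp (of_real (- 2 * pi) * of_real t) * zp s x) has_vector_derivative
     of_real (- 2 * pi) * (exp (of_real (- 2 * pi) * of_real t) * zp s x)) (at t)"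
    by (rule has_vector_derivative_real_field) (auto intro!: derivative_eq_intros)
  ultimately show ?thesis by simp
qed

section \<open>The density on a smaller circle and its potential\<close>

context extremal_param
begin

definition dens :: "real \<Rightarrow> real \<Rightarrow> real" where
  "dens \<sigma> y = Re (gf (zp \<sigma> y))"

context
  fixes \<sigma> :: real
  assumes \<sigma>: "\<sigma> > 0"
begin

lemma continuous_on_dens: "continuous_on S (dens \<sigma>)"
  unfolding dens_def[abs_def] using norm_zp_less[OF \<sigma>]
  by (intro continuous_intros continuous_on_compose2[OF holomorphic_on_imp_continuous_on[OF gf_holomorphic]]) auto

lemma dens_nonneg: "dens \<sigma> y \<ge> 0"
  unfolding dens_def using Re_gf_pos[OF norm_zp_less[OF \<sigma>]] less_imp_le by blast

lemma gf_scaled_holomorphic: "(\<lambda>u. gf (zp \<sigma> 0 * u)) holomorphic_on ball 0 (exp (2 * pi * \<sigma>))"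
proof (rule holomorphic_on_compose_gen[OF _ gf_holomorphic, unfolded o_def])
  show "(\<lambda>u. zp \<sigma> 0 * u) ` ball 0 (exp (2 * pi * \<sigma>)) \<subseteq> ball 0 1"
    by (auto simp: norm_mult norm_zp exp_minus field_simps)
qed (intro holomorphic_intros)

lemma conv_pk_dens:
  assumes t: "t > 0"
  shows "conv_pk (dens \<sigma>) t x = Re (gf (zp (t + \<sigma>) x))"
proof -
  have "exp (2 * pi * \<sigma>) > 1" using \<sigma> by simp
  from poisson_Re[OF gf_scaled_holomorphic this t, of x] show ?thesis
    unfolding conv_pk_def dens_def
    by (intro integral_unique) (simp add: zp_mult add.commute)
qed

lemma integral_dens: "(dens \<sigma> has_integral (1 - m)) {0..1}"
proof -
  have "exp (2 * pi * \<sigma>) > 1" using \<sigma> by simp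
  from mean_value_Re[OF gf_scaled_holomorphic this] show ?thesis
    unfolding dens_def[abs_def] by (simp add: zp_mult at_0)
qed

lemma Re_\<Phi>_zp_has_derivative:
  assumes "t > 0"
  shows "((\<lambda>t. Re (\<Phi> (zp (t + \<sigma>) x))) has_real_derivative
     - pi * (Re (gf (zp (t + \<sigma>) x)) + m * pk (t + \<sigma>) x - 1)) (at t)"
proof -
  let ?z = "zp (t + \<sigma>) x"
  have ts: "t + \<sigma> > 0" using assms \<sigma> by simp
  obtain D where D: "(\<Phi> has_field_derivative D) (at ?z)"
     "?z * D = (gf ?z + of_real m * ((1 + ?z) / (1 - ?z)) - 1) / 2"
    using \<Phi>_has_derivative[OF norm_zp_less[OF ts, of x]] by blast
  have "((\<Phi> \<circ> (\<lambda>t. zp (t + \<sigma>) x)) has_vector_derivative (of_real (- 2 * pi) * ?z) * D) (at t)"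
    by (rule field_vector_diff_chain_at[OF zp_has_vector_derivative D(1)])
  from bounded_linear.has_vector_derivative[OF bounded_linear_Re this]
  have "((\<lambda>t. Re (\<Phi> (zp (t + \<sigma>) x))) has_real_derivative Re (of_real (- 2 * pi) * (?z * D))) (at t)"
    by (simp only: o_def has_real_derivative_iff_has_vector_derivative mult.assoc)
  moreover have "Re (of_real (- 2 * pi) * (?z * D)) = - pi * (Re (gf ?z) + m * Re ((1 + ?z) / (1 - ?z)) - 1)"
  proof -
    have "Re (of_real (- 2 * pi) * ((G + of_real m * X - 1) / 2)) = - pi * (Re G + m * Re X - 1)" for G X
      by simp
    then show ?thesis unfolding D(2) .
  qed
  ultimately show ?thesis unfolding pk_Re[OF ts] by (simp only:)
qed

lemma conv_lnk_dens_bound: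
  assumes t: "t > 0"
  shows "\<bar>conv_lnk (dens \<sigma>) t x\<bar> \<le> (1 - m) * (- ln (1 - exp (- 2 * pi * t)))"
proof -
  let ?e = "- ln (1 - exp (- 2 * pi * t))"
  have "norm (integral {0..1} (\<lambda>y. dens \<sigma> y * lnk t (y - x))) \<le> integral {0..1} (\<lambda>y. dens \<sigma> y * ?e)"
  proof (rule integral_norm_bound_integral)
    fix y
    have "dens \<sigma> y * \<bar>lnk t (y - x)\<bar> \<le> dens \<sigma> y * ?e"
      by (intro mult_left_mono lnk_decay t dens_nonneg)
    then show "norm (dens \<sigma> y * lnk t (y - x)) \<le> dens \<sigma> y * ?e"
      by (simp only: real_norm_def abs_mult abs_of_nonneg[OF dens_nonneg])
  qed (use t in \<open>auto intro!: integrable_continuous_real continuous_intros continuous_on_dens\<close>)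
  also have "integral {0..1} (\<lambda>y. dens \<sigma> y * ?e) = (1 - m) * ?e"
    using has_integral_mult_left[OF integral_dens, of ?e] by (rule integral_unique)
  finally show ?thesis by (simp add: conv_lnk_def)
qed

text \<open>Both sides have the same derivative in t and tend to 0 as t -> infinity, where
  \<open>zp\<close> shrinks to the centre and \<Phi> vanishes.\<close>

lemma conv_lnk_dens:
  assumes t: "t > 0"
  shows "conv_lnk (dens \<sigma>) t x = Re (\<Phi> (zp (t + \<sigma>) x)) - m * lnk (t + \<sigma>) x"
proof -
  define d where "d t = conv_lnk (dens \<sigma>) t x - (Re (\<Phi> (zp (t + \<sigma>) x)) - m * lnk (t + \<sigma>) x)" for t
  have d_deriv: "(d has_real_derivative 0) (at t)" if t: "t > 0" for t
  proof -
    have ts: "t + \<sigma> > 0" using t \<sigma> by simp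
    have "((\<lambda>t. lnk (t + \<sigma>) x) has_real_derivative - pi * (pk (t + \<sigma>) x - 1)) (at t)"
      using lnk_has_derivative[OF ts, of x] by (simp only: DERIV_shift)
    then have "(d has_real_derivative - pi * (conv_pk (dens \<sigma>) t x - integral {0..1} (dens \<sigma>))
       - (- pi * (Re (gf (zp (t + \<sigma>) x)) + m * pk (t + \<sigma>) x - 1) - m * (- pi * (pk (t + \<sigma>) x - 1)))) (at t)"
      unfolding d_def[abs_def]
      by (intro DERIV_diff DERIV_cmult conv_lnk_has_derivative[OF continuous_on_dens t] Re_\<Phi>_zp_has_derivative t)
    then show ?thesis
      unfolding conv_pk_dens[OF t] integral_unique[OF integral_dens] by (simp add: algebra_simps)
  qed
  have const: "d u = d t" if "u > 0" for u
    using that t d_deriv by (intro DERIV_isconst3[where a=0 and b="max u t + 1"]) auto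
  have "(d \<longlongrightarrow> 0) at_top"
  proof -
    let ?e = "\<lambda>t. - ln (1 - exp (- 2 * pi * t))"
    have shift: "filterlim (\<lambda>t. t + \<sigma>) at_top at_top"
      using filterlim_tendsto_add_at_top[OF tendsto_const filterlim_ident, of \<sigma>] by (simp add: add.commute)
    have "((\<lambda>t. conv_lnk (dens \<sigma>) t x) \<longlongrightarrow> 0) at_top"
    proof (rule Lim_null_comparison)
      show "\<forall>\<^sub>F t in at_top. norm (conv_lnk (dens \<sigma>) t x) \<le> (1 - m) * ?e t"
        using eventually_gt_at_top[of 0] by eventually_elim (use conv_lnk_dens_bound in simp)
      show "((\<lambda>t. (1 - m) * ?e t) \<longlongrightarrow> 0) at_top"
        using tendsto_mult_left[OF lnk_decay_tendsto, of "1 - m"] by simp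
    qed
    moreover have "((\<lambda>t. lnk (t + \<sigma>) x) \<longlongrightarrow> 0) at_top"
    proof (rule Lim_null_comparison)
      show "\<forall>\<^sub>F t in at_top. norm (lnk (t + \<sigma>) x) \<le> ?e (t + \<sigma>)"
        using eventually_gt_at_top[of 0]
      proof eventually_elim
        case (elim t)
        then show ?case using lnk_decay[of "t + \<sigma>" x] \<sigma> by simp
      qed
      show "((\<lambda>t. ?e (t + \<sigma>)) \<longlongrightarrow> 0) at_top"
        by (rule filterlim_compose[OF lnk_decay_tendsto shift])
    qed
    moreover have "((\<lambda>t. Re (\<Phi> (zp (t + \<sigma>) x))) \<longlongrightarrow> Re (\<Phi> 0)) at_top"
    proof (rule tendsto_Re)
      obtain D where "(\<Phi> has_field_derivative D) (at 0)" using \<Phi>_has_derivative[of 0] by auto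
      then have "isCont \<Phi> 0" by (rule DERIV_isCont)
      moreover have "((\<lambda>t. zp (t + \<sigma>) x) \<longlongrightarrow> 0) at_top"
      proof (rule Lim_null_comparison)
        show "\<forall>\<^sub>F t in at_top. norm (zp (t + \<sigma>) x) \<le> exp (- 2 * pi * (t + \<sigma>))"
          by (simp add: norm_zp)
        show "((\<lambda>t. exp (- 2 * pi * (t + \<sigma>))) \<longlongrightarrow> 0) at_top"
          by (rule filterlim_compose[OF exp_at_bot filterlim_tendsto_neg_mult_at_bot[OF tendsto_const _ shift]]) simp
      qed
      ultimately show "((\<lambda>t. \<Phi> (zp (t + \<sigma>) x)) \<longlongrightarrow> \<Phi> 0) at_top"
        by (rule isCont_tendsto_compose)
    qed
    ultimately have "(d \<longlongrightarrow> 0 - (Re (\<Phi> 0) - m * 0)) at_top"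
      unfolding d_def[abs_def] by (intro tendsto_diff tendsto_mult tendsto_const)
    then show ?thesis by (simp add: at_0)
  qed
  moreover have "(d \<longlongrightarrow> d t) at_top"
    by (rule tendsto_eventually, rule eventually_mono[OF eventually_gt_at_top[of 0]], rule const)
  ultimately have "d t = 0" using tendsto_unique trivial_limit_at_top_linorder by blast
  then show ?thesis by (simp add: d_def)
qed

text \<open>Only the density is smoothed to height \<sigma>; the atom is not. Lifting the atom's
  kernel from t to t + \<sigma>, where the sum is the real part of \<Phi>, costs m pi \<sigma> \<le>
  pi \<sigma>.\<close>

lemma potential_lower_bound:
  assumes t: "t > 0"
  shows "m * lnk t x + conv_lnk (dens \<sigma>) t x \<ge> - m\<^sup>2 / (2 * q) - pi * \<sigma>"
proof -
  have ts: "t + \<sigma> > 0" using t \<sigma> by simp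
  have "m * (lnk t x - lnk (t + \<sigma>) x) \<ge> m * (- pi * \<sigma>)"
    using lnk_shift_ge[OF t \<sigma>] m by (intro mult_left_mono) auto
  moreover have "m * (- pi * \<sigma>) \<ge> - pi * \<sigma>"
    using m_less_1 \<sigma> m by (simp add: mult_le_cancel_right1 mult.commute[of m])
  moreover have "Re (\<Phi> (zp (t + \<sigma>) x)) \<ge> - m\<^sup>2 / (2 * q)"
    by (rule Re_\<Phi>_ge[OF norm_zp_less[OF ts]])
  ultimately show ?thesis unfolding conv_lnk_dens[OF t] right_diff_distrib by linarith
qed

end

end

section \<open>An atom plus a density as a measure on the torus\<close>

lemma atom_mixture:
  assumes m: "0 \<le> m" "m < 1" and n: "n \<in> borel_measurable borel" "\<And>y. n y \<ge> 0"
    and int: "(n has_integral (1 - m)) {0..1}"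
  obtains \<rho> where "torus_prob \<rho>" "measure \<rho> {0} \<ge> m"
    "\<And>f. f \<in> borel_measurable borel \<Longrightarrow>
       (\<integral>\<^sup>+ y. f y \<partial>\<rho>) = ennreal m * f 0 + (\<integral>\<^sup>+ y. ennreal (n y) * indicator {0..1} y * f y \<partial>lborel)"
proof -
  have [measurable]: "n \<in> borel_measurable borel" by fact
  \<comment> \<open>The half-open interval puts all mass on the fundamental domain, as
    \<open>torus_prob\<close> demands; in integrals the endpoint 1 is a null set.\<close>
  define D :: "real measure" where "D = density lborel (\<lambda>y. ennreal (n y / (1 - m)) * indicator {0..<1} y)"
  define K where "K b = (if b then return borel 0 else D)" for b :: bool
  \<comment> \<open>A Bernoulli choice between the unit atom at 0 and D realises the convex
    combination with weights m and 1 - m.\<close>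
  define \<rho> where "\<rho> = measure_pmf (bernoulli_pmf m) \<bind> K"
  have AE1: "AE y::real in lborel. indicator {0..<1} y = (indicator {0..1} y :: ennreal)"
    using AE_lborel_singleton[of "1::real"] by eventually_elim (auto simp: indicator_def)
  have nn: "(\<integral>\<^sup>+ y. ennreal (n y) * indicator {0..1} y \<partial>lborel) = ennreal (1 - m)"
    using n int by (intro nn_integral_has_integral_lebesgue') auto
  have D_int: "(\<integral>\<^sup>+ y. f y \<partial>D) * ennreal (1 - m) = (\<integral>\<^sup>+ y. ennreal (n y) * indicator {0..1} y * f y \<partial>lborel)"
    if [measurable]: "f \<in> borel_measurable borel" for f
  proof -
    have "(\<integral>\<^sup>+ y. f y \<partial>D) * ennreal (1 - m) = (\<integral>\<^sup>+ y. ennreal (n y / (1 - m)) * indicator {0..<1} y * f y * ennreal (1 - m) \<partial>lborel)"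
      unfolding D_def by (subst nn_integral_density) (auto simp: nn_integral_multc)
    also have "\<dots> = (\<integral>\<^sup>+ y. ennreal (n y) * indicator {0..1} y * f y \<partial>lborel)"
    proof (rule nn_integral_cong_AE)
      show "AE y in lborel. ennreal (n y / (1 - m)) * indicator {0..<1} y * f y * ennreal (1 - m)
          = ennreal (n y) * indicator {0..1} y * f y"
        using AE1
      proof eventually_elim
        case (elim y)
        have "ennreal (n y / (1 - m)) * ennreal (1 - m) = ennreal (n y)"
          using n(2)[of y] m by (simp add: ennreal_mult''[symmetric])
        then show ?case unfolding elim by (metis (no_types, lifting) mult.assoc mult.commute)
      qed
    qed
    finally show ?thesis .
  qed
  have setsD [simp]: "sets D = sets borel" by (simp add: D_def)
  then have spaceD [simp]: "space D = UNIV" by (simp add: D_def)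
  have "prob_space D"
  proof
    have "emeasure D (space D) * ennreal (1 - m) = ennreal (1 - m)"
      using D_int[of "\<lambda>_. 1"] nn by simp
    also have "\<dots> = 1 * ennreal (1 - m)" by simp
    finally have "ennreal (1 - m) * emeasure D (space D) = ennreal (1 - m) * 1" by (simp only: mult.commute)
    then show "emeasure D (space D) = 1"
      using m by (subst (asm) ennreal_mult_cancel_left) auto
  qed
  then have "K b \<in> space (subprob_algebra borel)" for b
    by (cases b) (auto simp: K_def space_subprob_algebra intro!: prob_space_imp_subprob_space prob_space_return)
  then have K: "K \<in> measurable (measure_pmf (bernoulli_pmf m)) (subprob_algebra borel)"
    by (simp add: measurable_pmf_measure1)
  have \<rho>_int: "(\<integral>\<^sup>+ y. f y \<partial>\<rho>) = ennreal m * f 0 + (\<integral>\<^sup>+ y. ennreal (n y) * indicator {0..1} y * f y \<partial>lborel)"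
    if f: "f \<in> borel_measurable borel" for f
  proof -
    have "(\<integral>\<^sup>+ y. f y \<partial>\<rho>) = (\<integral>\<^sup>+ b. \<integral>\<^sup>+ y. f y \<partial>K b \<partial>measure_pmf (bernoulli_pmf m))"
      unfolding \<rho>_def by (rule nn_integral_bind[OF f K])
    also have "\<dots> = (\<integral>\<^sup>+ y. f y \<partial>return borel 0) * ennreal m + (\<integral>\<^sup>+ y. f y \<partial>D) * ennreal (1 - m)"
      using m by (subst nn_integral_bernoulli_pmf) (auto simp: K_def)
    also have "(\<integral>\<^sup>+ y. f y \<partial>return borel 0) = f 0"
      using f by (intro nn_integral_return) auto
    finally show ?thesis by (simp add: D_int[OF f] mult.commute)
  qed
  have sets: "sets \<rho> = sets borel"
    unfolding \<rho>_def by (rule sets_bind) (auto simp: K_def)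
  then have space: "space \<rho> = UNIV" by (metis sets_eq_imp_space_eq space_borel)
  have em: "emeasure \<rho> A = ennreal m * indicator A 0 + (\<integral>\<^sup>+ y. ennreal (n y) * indicator {0..1} y * indicator A y \<partial>lborel)"
    if "A \<in> sets borel" for A
    using \<rho>_int[of "indicator A"] that sets by simp
  have prob: "prob_space \<rho>"
  proof
    have "emeasure \<rho> (space \<rho>) = ennreal m + ennreal (1 - m)"
      using em[of UNIV] nn by (simp add: space)
    also have "\<dots> = 1" using m by (simp flip: ennreal_plus)
    finally show "emeasure \<rho> (space \<rho>) = 1" .
  qed
  have null: "emeasure \<rho> (- {0..<1}) = 0"
  proof -
    have "(\<integral>\<^sup>+ y. ennreal (n y) * indicator {0..1} y * indicator (- {0..<1}) y \<partial>lborel) = (\<integral>\<^sup>+ y. 0 \<partial>(lborel :: real measure))"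
      using AE1 by (intro nn_integral_cong_AE) (auto elim!: eventually_mono simp: indicator_def split: if_splits)
    then show ?thesis using em[of "- {0..<1}"] by simp
  qed
  interpret prob_space \<rho> by fact
  have "ennreal m \<le> emeasure \<rho> {0}" using em[of "{0}"] by simp
  then have "m \<le> measure \<rho> {0}" by (simp add: emeasure_eq_measure)
  then show thesis using that[of \<rho>] prob sets null \<rho>_int by (simp add: torus_prob_def)
qed

text \<open>The integrand may change sign; \<open>ennreal\<close> cuts it off at 0, which can only
  enlarge the right-hand side.\<close>

lemma nn_integral_ge_integral:
  fixes f :: "real \<Rightarrow> real"
  assumes "continuous_on {0..1} f"
  shows "ennreal (integral {0..1} f) \<le> (\<integral>\<^sup>+ y. ennreal (f y) * indicator {0..1} y \<partial>lborel)"
proof -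
  have c: "continuous_on {0..1} (\<lambda>y. max 0 (f y))" using assms by (intro continuous_intros)
  have "integral {0..1} f \<le> integral {0..1} (\<lambda>y. max 0 (f y))"
    using assms c by (intro integral_le integrable_continuous_real) auto
  then have "ennreal (integral {0..1} f) \<le> ennreal (integral {0..1} (\<lambda>y. max 0 (f y)))"
    by (rule ennreal_leI)
  also have "\<dots> = (\<integral>\<^sup>+ y. ennreal (max 0 (f y)) * indicator {0..1} y \<partial>lborel)"
    using c by (intro nn_integral_has_integral_lebesgue'[symmetric] integrable_integral integrable_continuous_real) auto
  also have "(\<lambda>y. ennreal (max 0 (f y))) = (\<lambda>y. ennreal (f y))"
    by (auto simp: max_def ennreal_neg)
  finally show ?thesis .
qed

context extremal_param
begin

text \<open>W is replaced by its minorant from \<open>Wshift_ge\<close> at height \<sigma>. With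
  total mass 1 this costs pi \<sigma> on top of the pi \<sigma> in
  \<open>potential_lower_bound\<close>.\<close>

lemma near_extremal_measure:
  assumes \<sigma>: "\<sigma> > 0"
  obtains \<rho> where "torus_prob \<rho>" "measure \<rho> {0} \<ge> m"
    "\<And>x. Wconv \<rho> x \<ge> ereal (- (m\<^sup>2 / (2 * q) + 2 * pi * \<sigma>))"
proof -
  note cont = continuous_on_dens[OF \<sigma>]
  have meas: "dens \<sigma> \<in> borel_measurable borel"
    by (rule borel_measurable_continuous_onI[OF cont])
  obtain \<rho> where \<rho>: "torus_prob \<rho>" "measure \<rho> {0} \<ge> m"
    "\<And>f. f \<in> borel_measurable borel \<Longrightarrow>
       (\<integral>\<^sup>+ y. f y \<partial>\<rho>) = ennreal m * f 0 + (\<integral>\<^sup>+ y. ennreal (dens \<sigma> y) * indicator {0..1} y * f y \<partial>lborel)"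
    using atom_mixture[OF less_imp_le[OF m] m_less_1 meas dens_nonneg[OF \<sigma>] integral_dens[OF \<sigma>]] by blast
  have "Wconv \<rho> x \<ge> ereal (- (m\<^sup>2 / (2 * q) + 2 * pi * \<sigma>))" for x
  proof -
    let ?l = "\<lambda>y. lnk \<sigma> (x - y) + ln 2 - pi * \<sigma>"
    have cl: "continuous_on S ?l" for S using \<sigma> by (intro continuous_intros) auto
    have I: "integral {0..1} (\<lambda>y. dens \<sigma> y * ?l y) = conv_lnk (dens \<sigma>) \<sigma> x + (1 - m) * (ln 2 - pi * \<sigma>)"
    proof -
      have "integral {0..1} (\<lambda>y. dens \<sigma> y * ?l y) = integral {0..1} (\<lambda>y. dens \<sigma> y * lnk \<sigma> (y - x) + dens \<sigma> y * (ln 2 - pi * \<sigma>))"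
      proof (rule integral_cong)
        fix y
        have "lnk \<sigma> (x - y) = lnk \<sigma> (y - x)" using lnk_minus[of \<sigma> "y - x"] by simp
        then show "dens \<sigma> y * ?l y = dens \<sigma> y * lnk \<sigma> (y - x) + dens \<sigma> y * (ln 2 - pi * \<sigma>)"
          by (simp add: algebra_simps)
      qed
      also have "\<dots> = conv_lnk (dens \<sigma>) \<sigma> x + integral {0..1} (\<lambda>y. dens \<sigma> y * (ln 2 - pi * \<sigma>))"
        unfolding conv_lnk_def using \<sigma>
        by (intro Henstock_Kurzweil_Integration.integral_add integrable_continuous_real continuous_intros cont) auto
      also have "integral {0..1} (\<lambda>y. dens \<sigma> y * (ln 2 - pi * \<sigma>)) = (1 - m) * (ln 2 - pi * \<sigma>)"
        using has_integral_mult_left[OF integral_dens[OF \<sigma>]] by (rule integral_unique)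
      finally show ?thesis .
    qed
    have "ennreal (m * ?l 0) \<le> ennreal m * Wshift (x - 0)"
    proof -
      have "ennreal (m * ?l 0) = ennreal m * ennreal (?l 0)" using m by (simp add: ennreal_mult')
      also have "\<dots> \<le> ennreal m * Wshift (x - 0)" by (intro mult_left_mono Wshift_ge[OF \<sigma>]) simp
      finally show ?thesis .
    qed
    moreover have "ennreal (integral {0..1} (\<lambda>y. dens \<sigma> y * ?l y)) \<le> (\<integral>\<^sup>+ y. ennreal (dens \<sigma> y) * indicator {0..1} y * Wshift (x - y) \<partial>lborel)"
    proof -
      have "ennreal (integral {0..1} (\<lambda>y. dens \<sigma> y * ?l y)) \<le> (\<integral>\<^sup>+ y. ennreal (dens \<sigma> y * ?l y) * indicator {0..1} y \<partial>lborel)"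
        by (intro nn_integral_ge_integral continuous_on_mult cont cl)
      also have "\<dots> \<le> (\<integral>\<^sup>+ y. ennreal (dens \<sigma> y) * indicator {0..1} y * Wshift (x - y) \<partial>lborel)"
      proof (rule nn_integral_mono)
        fix y
        have "ennreal (dens \<sigma> y * ?l y) = ennreal (dens \<sigma> y) * ennreal (?l y)"
          using dens_nonneg[OF \<sigma>] by (rule ennreal_mult')
        also have "\<dots> \<le> ennreal (dens \<sigma> y) * Wshift (x - y)"
          by (intro mult_left_mono Wshift_ge[OF \<sigma>]) simp
        finally show "ennreal (dens \<sigma> y * ?l y) * indicator {0..1} y \<le> ennreal (dens \<sigma> y) * indicator {0..1} y * Wshift (x - y)"
          by (auto simp: indicator_def)
      qed
      finally show ?thesis .
    qed
    ultimately have "ennreal (m * ?l 0) + ennreal (integral {0..1} (\<lambda>y. dens \<sigma> y * ?l y)) \<le> (\<integral>\<^sup>+ y. Wshift (x - y) \<partial>\<rho>)"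
      by (subst \<rho>(3)) (auto intro!: add_mono)
    \<comment> \<open>Either term may be negative and is then cut off at 0, so subadditivity takes
      the place of additivity.\<close>
    moreover have "ennreal (a + b) \<le> ennreal a + ennreal b" for a b
      by (cases "a \<ge> 0"; cases "b \<ge> 0") (auto simp: ennreal_plus ennreal_neg intro!: ennreal_leI)
    moreover have "ln 2 - (m\<^sup>2 / (2 * q) + 2 * pi * \<sigma>) \<le> m * ?l 0 + integral {0..1} (\<lambda>y. dens \<sigma> y * ?l y)"
      unfolding I using potential_lower_bound[OF \<sigma> \<sigma>, of x] by (simp add: algebra_simps)
    ultimately have "ennreal (ln 2 - (m\<^sup>2 / (2 * q) + 2 * pi * \<sigma>)) \<le> (\<integral>\<^sup>+ y. Wshift (x - y) \<partial>\<rho>)"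
      by (meson ennreal_leI order_trans)
    then have "enn2ereal (ennreal (ln 2 - (m\<^sup>2 / (2 * q) + 2 * pi * \<sigma>))) \<le> enn2ereal (\<integral>\<^sup>+ y. Wshift (x - y) \<partial>\<rho>)"
      by (simp only: less_eq_ennreal.rep_eq)
    moreover have "ereal r \<le> enn2ereal (ennreal r)" for r
      by (cases "r \<ge> 0") (auto simp: enn2ereal_ennreal ennreal_neg zero_ennreal.rep_eq)
    ultimately have "ereal (ln 2 - (m\<^sup>2 / (2 * q) + 2 * pi * \<sigma>)) \<le> enn2ereal (\<integral>\<^sup>+ y. Wshift (x - y) \<partial>\<rho>)"
      using order_trans by blast
    then show ?thesis unfolding Wconv_def by (cases "enn2ereal (\<integral>\<^sup>+ y. Wshift (x - y) \<partial>\<rho>)") auto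
  qed
  then show thesis using \<rho>(1,2) that by blast
qed

end

section \<open>Choice of the parameters\<close>

lemma discr_ge_atom:
  assumes "torus_prob \<rho>"
  shows "measure \<rho> {0} \<le> discr \<rho>"
proof -
  interpret prob_space \<rho> using assms by (simp add: torus_prob_def)
  have "bdd_above ((\<lambda>p. measure \<rho> (arc (fst p) (snd p)) - snd p) ` (UNIV \<times> {0..<1}))"
  proof (rule bdd_aboveI2)
    fix p :: "real \<times> real" assume "p \<in> UNIV \<times> {0..<1}"
    then have "snd p \<ge> 0" by auto
    then show "measure \<rho> (arc (fst p) (snd p)) - snd p \<le> 1"
      using prob_le_1[of "arc (fst p) (snd p)"] by linarith
  qed
  from cSUP_upper[OF _ this, of "(0, 0)"] have "measure \<rho> (arc 0 0) - 0 \<le> discr \<rho>"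
    unfolding discr_def by simp
  moreover have "arc 0 0 = {0}"
    by (auto simp: arc_def frac_eq)
  ultimately show ?thesis by simp
qed

lemma Henergy_le:
  assumes "\<And>x. Wconv \<rho> x \<ge> ereal (- h)"
  shows "Henergy \<rho> \<le> ereal h"
proof -
  have "ereal (- h) \<le> essinf (restrict_space lborel {0..<1}) (Wconv \<rho>)"
    unfolding essinf_def using assms by (intro Sup_upper) auto
  then have "- essinf (restrict_space lborel {0..<1}) (Wconv \<rho>) \<le> - ereal (- h)"
    by (simp only: ereal_minus_le_minus)
  then show ?thesis by (simp add: Henergy_def)
qed

lemma discr_sharp:
  fixes c :: real
  assumes c: "c < sqrt 2"
  shows "\<exists>\<rho>. torus_prob \<rho> \<and> Henergy \<rho> \<noteq> \<infinity> \<and> discr \<rho> > c * sqrt (real_of_ereal (Henergy \<rho>))"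
proof -
  \<comment> \<open>A negative c is raised to 0 so that the inequality can be squared.\<close>
  define k where "k = max c 0"
  have k: "0 \<le> k" "k < sqrt 2" "c \<le> k" using c by (auto simp: k_def)
  have k2: "k\<^sup>2 < 2" using power_strict_mono[OF k(2,1), of 2] by simp
  \<comment> \<open>The ratio reached in the limit \<sigma> -> 0 is sqrt (2 q), so any q above k^2 /
    2 leaves room.\<close>
  then obtain q where kq: "k\<^sup>2 / 2 < q" "q < 1" using dense[of "k\<^sup>2 / 2" 1] by auto
  have q0: "0 < q" using kq(1) by (smt (verit) zero_le_power2 divide_nonneg_pos)
  define m where "m = sqrt (1 - q\<^sup>2)"
  have "q\<^sup>2 < 1" using kq q0 by (simp add: power_less_one_iff)
  then have m: "m > 0" "m\<^sup>2 + q\<^sup>2 = 1" by (auto simp: m_def)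
  interpret extremal_param q m by unfold_locales (use kq q0 m in auto)
  \<comment> \<open>The slack m^2 - k^2 m^2 / (2 q) is 2 e. The choice of \<sigma> below makes the
    smoothing loss 2 pi \<sigma> equal to e / 2, and k^2 < 2 keeps its multiple within the
    slack.\<close>
  define e where "e = m\<^sup>2 * (1 - k\<^sup>2 / (2 * q)) / 2"
  have "k\<^sup>2 / (2 * q) < 1" using kq q0 by (simp add: field_simps)
  then have e: "e > 0" unfolding e_def using m(1) by simp
  define \<sigma> where "\<sigma> = e / (4 * pi)"
  have \<sigma>: "\<sigma> > 0" using e by (simp add: \<sigma>_def)
  define h where "h = m\<^sup>2 / (2 * q) + 2 * pi * \<sigma>"
  have hpos: "h > 0" unfolding h_def using m(1) q0 \<sigma> by (intro add_pos_pos) auto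
  have "k\<^sup>2 * h = m\<^sup>2 * (k\<^sup>2 / (2 * q)) + k\<^sup>2 * (e / 2)"
    by (simp add: h_def \<sigma>_def algebra_simps)
  also have "k\<^sup>2 * (e / 2) < 2 * e" using k2 e by simp
  also have "m\<^sup>2 * (k\<^sup>2 / (2 * q)) + 2 * e = m\<^sup>2"
  proof -
    have "2 * e = m\<^sup>2 * (1 - k\<^sup>2 / (2 * q))" by (simp add: e_def)
    then show ?thesis by (simp only: right_diff_distrib)
  qed
  finally have "k\<^sup>2 * h < m\<^sup>2" by simp
  then have "sqrt (k\<^sup>2 * h) < sqrt (m\<^sup>2)" by (rule real_sqrt_less_mono)
  then have kh: "k * sqrt h < m" using k(1) m(1) by (simp add: real_sqrt_mult)
  obtain \<rho> where \<rho>: "torus_prob \<rho>" "measure \<rho> {0} \<ge> m" "\<And>x. Wconv \<rho> x \<ge> ereal (- h)"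
    using near_extremal_measure[OF \<sigma>] unfolding h_def by blast
  have H: "Henergy \<rho> \<le> ereal h" by (rule Henergy_le[OF \<rho>(3)])
  then have fin: "Henergy \<rho> \<noteq> \<infinity>" by auto
  let ?H = "real_of_ereal (Henergy \<rho>)"
  have H0: "0 \<le> ?H" using discr_le[OF \<rho>(1) fin] by simp
  \<comment> \<open>\<open>real_of_ereal\<close> sends minus infinity to 0, a case of the split that
    h > 0 covers.\<close>
  have Hh: "?H \<le> h" using H fin hpos by (cases "Henergy \<rho>") auto
  have "c * sqrt ?H \<le> k * sqrt ?H" using k(3) H0 by (intro mult_right_mono) auto
  also have "\<dots> \<le> k * sqrt h" using Hh k(1) by (intro mult_left_mono) auto
  also have "\<dots> < m" by (rule kh)
  also have "\<dots> \<le> discr \<rho>" using \<rho>(2) discr_ge_atom[OF \<rho>(1)] by linarith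
  finally show ?thesis using \<rho>(1) fin by blast
qed

theorem theorem1p4:
  shows "(\<forall>\<rho>. torus_prob \<rho> \<longrightarrow>
            Henergy \<rho> = \<infinity> \<or> discr \<rho> \<le> sqrt 2 * sqrt (real_of_ereal (Henergy \<rho>)))
       \<and> (\<forall>c::real. c < sqrt 2 \<longrightarrow>
            (\<exists>\<rho>. torus_prob \<rho> \<and> Henergy \<rho> \<noteq> \<infinity> \<and>
                 discr \<rho> > c * sqrt (real_of_ereal (Henergy \<rho>))))"
  using discr_le discr_sharp by blast

end
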